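(* Assume $\sum_i r_i=\sum_j c_j=1$. Consider the greedy Sinkhorn-type algorithm described in the context, started from $(x_{\mathrm{init}},y_{\mathrm{init}},a_{\mathrm{init}})$, and let $(x^u,y^u,a^u)$ be the dual variables after $u$ iterations. Let $$c_g=\max_{\tilde x,\tilde y,\tilde a}f(\tilde x,\tilde y,\tilde a)-f(x_{\mathrm{init}},y_{\mathrm{init}},a_{\mathrm{init}}),\qquad c_d=\max_{1\le m\le K+L}\lVert D_m\rVert_\infty .$$ Then the greedy algorithm outputs, in $O(c_g\epsilon^{-2})$ iterations, dual variables $(x,y,a)$ satisfying $\lVert\nabla f(x,y,a)\rVert_1\le\epsilon$. That is, there is a constant $A$ depending only on $\eta,K,L,c_d$ such that for every $\epsilon\in(0,1]$ there is an index $u\le A\,c_g\,\epsilon^{-2}$ for which $(x,y,a)=(x^u,y^u,a^u)$ satisfies $$\lVert\nabla f(x,y,a)\rVert_1\le\epsilon .$$ Moreover, the matrix $P$ associated with the output dual variables satisfies $$\lVert P\mathbf{1}-r\rVert_1+\lVert P^{\top}\mathbf{1}-c\rVert_1+\sum_{k=1}^K|\min(P\cdot D_k,0)|+\sum_{l=1}^L|P\cdot D_{l+K}|\le\epsilon .$$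
   Context: Data: $\eta>0$; $C,D_1,\dots,D_{K+L}\in\mathbb{R}^{n\times n}$; $r,c\in\mathbb{R}^n$ densities. $M\cdot M'=\sum_{ij}m_{ij}m'_{ij}$; $\lVert\cdot\rVert_1,\lVert\cdot\rVert_\infty$ are entrywise norms; $\exp$ of a matrix is entrywise; $\mathbf{1}$ is the all-ones vector. $\mathrm{KL}(p\,\|\,q)=\sum_i p_i\log(p_i/q_i)$. For $x,y\in\mathbb{R}^n$, $a\in\mathbb{R}^{K+L}$, the Lyapunov function is $$f(x,y,a)=-\frac1\eta\sum_{ij}\exp\Big(\eta\big(-C_{ij}+\sum_{m=1}^{K+L}a_m(D_m)_{ij}+x_i+y_j\big)-1\Big)+\sum_i x_ir_i+\sum_j y_jc_j-\frac1\eta\sum_{k=1}^K\exp(-\eta a_k-1).$$ The matrix associated with $(x,y,a)$ is $P=\exp\big(\eta(-C+\sum_{m}a_mD_m+x\mathbf{1}^{\top}+\mathbf{1}y^{\top})-1\big)$. Put $d_k=\exp(-\eta a_k-1)-P\cdot D_k$ for $k=1,\dots,K$ and $d_{l+K}=-P\cdot D_{l+K}$ for $l=1,\dots,L$. Update steps on the current $(x,y,a)$: - $x$ update: $x\leftarrow\operatorname{argmax}_{\tilde x}f(\tilde x,y,a)$. - $y$ update: $y\leftarrow\operatorname{argmax}_{\tilde y}f(x,\tilde y,a)$. - $a$ update: take $(a',t')\in\operatorname{argmax}_{\tilde a\in\mathbb{R}^{K+L},\,\tilde t\in\mathbb{R}}f(x+\tilde t\mathbf{1},y,\tilde a)$ and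 set $a\leftarrow a'$, $x\leftarrow x+t'\mathbf{1}$. Greedy algorithm: at each iteration compute, for the current $(x,y,a)$ with associated $P$, $$Q_x=\mathrm{KL}(r\,\|\,P\mathbf{1}),\quad Q_y=\mathrm{KL}(c\,\|\,P^{\top}\mathbf{1}),$$ $$Q_a=\sum_{k=1}^K|d_k|\min\Big(\frac1{8\eta},\frac{|d_k|}{8\eta c_d+4\eta(K+L)c_d^2}\Big)+\sum_{l=1}^L\frac{d_{l+K}^2}{2\eta(K+L)c_d^2},$$ and perform exactly one update step: the $x$ (resp. $y$, $a$) update if $Q_x$ (resp. $Q_y$, $Q_a$) is the largest of $Q_x,Q_y,Q_a$. The maximum defining $c_g$ and the maximizers in the update steps are assumed to exist. *)

theory Defs
  imports "HOL-Analysis.Derivative" "Jordan_Normal_Form.Matrix"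
begin

text \<open>Vectors and matrices of varying size are those of \<^theory>\<open>Jordan_Normal_Form.Matrix\<close>, indexed from 0.
  The matrices \<open>D\<^sub>1, \<dots>, D\<^bsub>K+L\<^esub>\<close> are \<open>D 0, \<dots>, D (K + L - 1)\<close>, the first \<open>K\<close> of them belonging to
  the inequality constraints.\<close>

definition ones :: "nat \<Rightarrow> real vec" where
  "ones n = vec n (\<lambda>_. 1)"

definition l1_norm :: "real vec \<Rightarrow> real" where
  "l1_norm v = (\<Sum>i<dim_vec v. \<bar>v $ i\<bar>)"

definition max_norm :: "real mat \<Rightarrow> real" where
  "max_norm M = Max {\<bar>M $$ (i, j)\<bar> | i j. i < dim_row M \<and> j < dim_col M}"

definition mat_dot :: "real mat \<Rightarrow> real mat \<Rightarrow> real" where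
  "mat_dot M N = (\<Sum>i<dim_row M. \<Sum>j<dim_col M. M $$ (i, j) * N $$ (i, j))"

text \<open>Terms with \<open>p $ i = 0\<close> vanish, which is the usual convention.\<close>

definition KL :: "real vec \<Rightarrow> real vec \<Rightarrow> real" where
  "KL p q = (\<Sum>i<dim_vec p. p $ i * ln (p $ i / q $ i))"

definition density :: "nat \<Rightarrow> real vec \<Rightarrow> bool" where
  "density n p \<longleftrightarrow> p \<in> carrier_vec n \<and> (\<forall>i<n. 0 \<le> p $ i) \<and> (\<Sum>i<n. p $ i) = 1"

type_synonym dual = "real vec \<times> real vec \<times> real vec"

definition dual_space :: "nat \<Rightarrow> nat \<Rightarrow> nat \<Rightarrow> dual set" where
  "dual_space n K L = carrier_vec n \<times> carrier_vec n \<times> carrier_vec (K + L)"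

fun lyapunov :: "real \<Rightarrow> nat \<Rightarrow> nat \<Rightarrow> nat \<Rightarrow> real mat \<Rightarrow> (nat \<Rightarrow> real mat) \<Rightarrow>
    real vec \<Rightarrow> real vec \<Rightarrow> dual \<Rightarrow> real" where
  "lyapunov \<eta> n K L C D r c (x, y, a) =
     - (1 / \<eta>) * (\<Sum>i<n. \<Sum>j<n.
         exp (\<eta> * (- C $$ (i, j) + (\<Sum>m<K + L. a $ m * D m $$ (i, j)) + x $ i + y $ j) - 1))
     + (\<Sum>i<n. x $ i * r $ i) + (\<Sum>j<n. y $ j * c $ j)
     - (1 / \<eta>) * (\<Sum>k<K. exp (- \<eta> * a $ k - 1))"

fun assoc_mat :: "real \<Rightarrow> nat \<Rightarrow> nat \<Rightarrow> nat \<Rightarrow> real mat \<Rightarrow> (nat \<Rightarrow> real mat) \<Rightarrow> dual \<Rightarrow> real mat" where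
  "assoc_mat \<eta> n K L C D (x, y, a) =
     mat n n (\<lambda>(i, j).
       exp (\<eta> * (- C $$ (i, j) + (\<Sum>m<K + L. a $ m * D m $$ (i, j)) + x $ i + y $ j) - 1))"

text \<open>The vector of all \<open>2n + K + L\<close> partial derivatives of a function of the dual variables.\<close>

fun gradient :: "nat \<Rightarrow> nat \<Rightarrow> nat \<Rightarrow> (dual \<Rightarrow> real) \<Rightarrow> dual \<Rightarrow> real vec" where
  "gradient n K L F (x, y, a) =
     vec n (\<lambda>i. deriv (\<lambda>s. F (x + s \<cdot>\<^sub>v unit_vec n i, y, a)) 0) @\<^sub>v
     vec n (\<lambda>j. deriv (\<lambda>s. F (x, y + s \<cdot>\<^sub>v unit_vec n j, a)) 0) @\<^sub>v
     vec (K + L) (\<lambda>m. deriv (\<lambda>s. F (x, y, a + s \<cdot>\<^sub>v unit_vec (K + L) m)) 0)"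

definition c_d :: "nat \<Rightarrow> nat \<Rightarrow> (nat \<Rightarrow> real mat) \<Rightarrow> real" where
  "c_d K L D = Max ((\<lambda>m. max_norm (D m)) ` {..<K + L})"

fun d_ineq :: "real \<Rightarrow> nat \<Rightarrow> nat \<Rightarrow> nat \<Rightarrow> real mat \<Rightarrow> (nat \<Rightarrow> real mat) \<Rightarrow> dual \<Rightarrow> nat \<Rightarrow> real" where
  "d_ineq \<eta> n K L C D (x, y, a) k =
     exp (- \<eta> * a $ k - 1) - mat_dot (assoc_mat \<eta> n K L C D (x, y, a)) (D k)"

definition d_eq :: "real \<Rightarrow> nat \<Rightarrow> nat \<Rightarrow> nat \<Rightarrow> real mat \<Rightarrow> (nat \<Rightarrow> real mat) \<Rightarrow> dual \<Rightarrow> nat \<Rightarrow> real" where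
  "d_eq \<eta> n K L C D z l = - mat_dot (assoc_mat \<eta> n K L C D z) (D (K + l))"

definition Q_x :: "real \<Rightarrow> nat \<Rightarrow> nat \<Rightarrow> nat \<Rightarrow> real mat \<Rightarrow> (nat \<Rightarrow> real mat) \<Rightarrow> real vec \<Rightarrow> dual \<Rightarrow> real" where
  "Q_x \<eta> n K L C D r z = KL r (assoc_mat \<eta> n K L C D z *\<^sub>v ones n)"

definition Q_y :: "real \<Rightarrow> nat \<Rightarrow> nat \<Rightarrow> nat \<Rightarrow> real mat \<Rightarrow> (nat \<Rightarrow> real mat) \<Rightarrow> real vec \<Rightarrow> dual \<Rightarrow> real" where
  "Q_y \<eta> n K L C D c z = KL c (transpose_mat (assoc_mat \<eta> n K L C D z) *\<^sub>v ones n)"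

text \<open>If \<open>c_d K L D = 0\<close>, the divisions by zero below are harmless: the equality terms are then
  \<open>0 / 0 = 0\<close>, and for \<open>K > 0\<close> the Lyapunov function has no maximizer.\<close>

definition Q_a :: "real \<Rightarrow> nat \<Rightarrow> nat \<Rightarrow> nat \<Rightarrow> real mat \<Rightarrow> (nat \<Rightarrow> real mat) \<Rightarrow> dual \<Rightarrow> real" where
  "Q_a \<eta> n K L C D z =
     (\<Sum>k<K. \<bar>d_ineq \<eta> n K L C D z k\<bar> *
        min (1 / (8 * \<eta>))
            (\<bar>d_ineq \<eta> n K L C D z k\<bar> /
              (8 * \<eta> * c_d K L D + 4 * \<eta> * real (K + L) * (c_d K L D)\<^sup>2)))
     + (\<Sum>l<L. (d_eq \<eta> n K L C D z l)\<^sup>2 / (2 * \<eta> * real (K + L) * (c_d K L D)\<^sup>2))"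

fun x_update :: "nat \<Rightarrow> (dual \<Rightarrow> real) \<Rightarrow> dual \<Rightarrow> dual \<Rightarrow> bool" where
  "x_update n F (x, y, a) (x', y', a') \<longleftrightarrow>
     is_arg_max (\<lambda>\<xi>. F (\<xi>, y, a)) (\<lambda>\<xi>. \<xi> \<in> carrier_vec n) x' \<and> y' = y \<and> a' = a"

fun y_update :: "nat \<Rightarrow> (dual \<Rightarrow> real) \<Rightarrow> dual \<Rightarrow> dual \<Rightarrow> bool" where
  "y_update n F (x, y, a) (x', y', a') \<longleftrightarrow>
     x' = x \<and> is_arg_max (\<lambda>\<upsilon>. F (x, \<upsilon>, a)) (\<lambda>\<upsilon>. \<upsilon> \<in> carrier_vec n) y' \<and> a' = a"

fun a_update :: "nat \<Rightarrow> nat \<Rightarrow> nat \<Rightarrow> (dual \<Rightarrow> real) \<Rightarrow> dual \<Rightarrow> dual \<Rightarrow> bool" where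
  "a_update n K L F (x, y, a) (x', y', a') \<longleftrightarrow>
     (\<exists>t'. is_arg_max (\<lambda>(\<alpha>, t). F (x + t \<cdot>\<^sub>v ones n, y, \<alpha>)) (\<lambda>(\<alpha>, t). \<alpha> \<in> carrier_vec (K + L)) (a', t')
         \<and> x' = x + t' \<cdot>\<^sub>v ones n) \<and> y' = y"

text \<open>Ties between the three quantities, and between several maximizers, may be broken arbitrarily.\<close>

definition greedy_step :: "real \<Rightarrow> nat \<Rightarrow> nat \<Rightarrow> nat \<Rightarrow> real mat \<Rightarrow> (nat \<Rightarrow> real mat) \<Rightarrow>
    real vec \<Rightarrow> real vec \<Rightarrow> dual \<Rightarrow> dual \<Rightarrow> bool" where
  "greedy_step \<eta> n K L C D r c z z' \<longleftrightarrow>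
     (let F = lyapunov \<eta> n K L C D r c;
          qx = Q_x \<eta> n K L C D r z;
          qy = Q_y \<eta> n K L C D c z;
          qa = Q_a \<eta> n K L C D z
      in (qy \<le> qx \<and> qa \<le> qx \<and> x_update n F z z') \<or>
         (qx \<le> qy \<and> qa \<le> qy \<and> y_update n F z z') \<or>
         (qx \<le> qa \<and> qy \<le> qa \<and> a_update n K L F z z'))"

definition greedy_run :: "real \<Rightarrow> nat \<Rightarrow> nat \<Rightarrow> nat \<Rightarrow> real mat \<Rightarrow> (nat \<Rightarrow> real mat) \<Rightarrow>
    real vec \<Rightarrow> real vec \<Rightarrow> dual \<Rightarrow> (nat \<Rightarrow> dual) \<Rightarrow> bool" where
  "greedy_run \<eta> n K L C D r c init z \<longleftrightarrow>
     init \<in> dual_space n K L \<and> z 0 = init \<and> (\<forall>u. greedy_step \<eta> n K L C D r c (z u) (z (Suc u)))"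

end

theory Submission
  imports Defs
begin

text \<open>
  Every iteration maximises the Lyapunov function \<open>f\<close> over one block of variables, so \<open>f\<close> never decreases
  along a run, and it has only \<open>c\<^sub>g\<close> to climb. The proof shows that each iteration after the first at
  which the gradient is still larger than \<open>\<epsilon>\<close> climbs by a fixed multiple of \<open>\<epsilon>\<^sup>2\<close>.

  Two facts make up this estimate, both for points whose matrix \<open>P\<close> has total mass 1; every update
  ends in such a point, because each block contains the direction in which all of \<open>P\<close> is rescaled.

  First, the scores \<open>Q\<^sub>x\<close>, \<open>Q\<^sub>y\<close>, \<open>Q\<^sub>a\<close> bound the gains from below: the gains are at least
  \<open>Q\<^sub>x/\<eta>\<close>, \<open>Q\<^sub>y/\<eta>\<close> and \<open>Q\<^sub>a/4\<close>. For \<open>x\<close> and \<open>y\<close> this is the explicit Sinkhorn rescaling. For \<open>a\<close>, the best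
  shift \<open>t\<close> turns the double sum into the logarithm of an exponential moment under \<open>P\<close>; a Hoeffding-type
  bound (\<open>exp_moment_bound\<close>) decouples the coordinates of the increment of \<open>a\<close>, and each coordinate is a
  scalar problem, solved by a step proportional to the minimum in \<open>Q\<^sub>a\<close> (inequalities) or to \<open>d\<^sub>m\<close> (equalities).

  Second, a gradient of norm more than \<open>\<epsilon>\<close> makes one score at least a multiple of \<open>\<epsilon>\<^sup>2\<close>
  (\<open>largest_score_bound\<close>): the gradient consists of \<open>r - P\<one>\<close>, \<open>c - P\<^sup>T\<one>\<close> and the \<open>d\<^sub>m\<close>, the first two
  of which are controlled by the Kullback-Leibler divergences through a Pinsker inequality.

  The starting point may have any mass \<open>s\<close>, and there the scores need not bound the gains. If its
  gradient is large, however, the distance \<open>c\<^sub>g\<close> to the maximum is itself at least a multiple of \<open>\<epsilon>\<^sup>2\<close>: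
  normalising the mass gains \<open>(s - 1 - ln s)/\<eta>\<close>, which grows quadratically near \<open>s = 1\<close>, and if \<open>s\<close> is close to 1
  then the normalised point still has a large gradient (\<open>initial_gap\<close>). So the first iteration
  costs at most a constant factor. The violation of the constraints in the second claim is
  dominated by the gradient term by term.
\<close>

text \<open>From here on \<open>$\<close> denotes only the components of vectors whose dimension is part of the data.\<close>

unbundle no vec_syntax

section \<open>Scalar inequalities\<close>

lemma exp_le_quadratic:
  fixes u :: real
  assumes "\<bar>u\<bar> \<le> 1"
  shows "exp u \<le> 1 + u + u\<^sup>2"
proof (cases "0 \<le> u")
  case True
  then show ?thesis using exp_bound assms by auto
next
  case False
  have "1 \<le> (1 + u + u\<^sup>2) * (1 - u)"
    using False by (simp add: algebra_simps power2_eq_square mult_nonneg_nonpos mult_nonneg_nonneg zero_le_mult_iff mult_le_0_iff)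
  also have "\<dots> \<le> (1 + u + u\<^sup>2) * exp (- u)"
    using exp_ge_add_one_self[of "- u"] assms by (intro mult_left_mono) auto
  finally show ?thesis by (simp add: exp_minus field_simps)
qed

text \<open>
  Both \<open>pinsker_quarter\<close> and the gain from normalising the mass rest on this form of \<open>ln \<surd>s \<le> \<surd>s - 1\<close>.
\<close>
lemma two_ln_sqrt_bound:
  fixes s :: real
  assumes "0 < s"
  shows "(sqrt s - 1)\<^sup>2 \<le> s - 1 - ln s"
proof -
  have "ln (sqrt s) \<le> sqrt s - 1" using assms by (intro ln_le_minus_one) auto
  then have "ln s \<le> 2 * (sqrt s - 1)" using assms by (simp add: ln_sqrt)
  then show ?thesis using assms by (simp add: power2_diff)
qed

text \<open>
  Since \<open>\<bar>\<surd>s - 1\<bar> = \<bar>s - 1\<bar> / (\<surd>s + 1)\<close>, the square root costs at most a factor of 3 as long as \<open>s \<le> 4\<close>; for larger \<open>s\<close>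
  the bound \<open>\<delta> \<le> 1\<close> takes over.
\<close>
lemma mass_defect_quadratic:
  fixes s \<delta> :: real
  assumes "0 < s" "0 \<le> \<delta>" "\<delta> \<le> 1" "\<delta> \<le> \<bar>s - 1\<bar>"
  shows "\<delta>\<^sup>2 / 9 \<le> s - 1 - ln s"
proof -
  have "\<delta> / 3 \<le> \<bar>sqrt s - 1\<bar>"
  proof (cases "s \<le> 4")
    case True
    have "\<bar>s - 1\<bar> = \<bar>sqrt s - 1\<bar> * (sqrt s + 1)"
    proof -
      have "s - 1 = (sqrt s - 1) * (sqrt s + 1)" using assms by (simp add: algebra_simps)
      then show ?thesis using assms by (simp add: abs_mult)
    qed
    also have "\<dots> \<le> \<bar>sqrt s - 1\<bar> * 3"
      using True real_sqrt_le_mono[of s 4] by (intro mult_left_mono) auto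
    finally show ?thesis using assms by simp
  next
    case False
    then have "2 \<le> sqrt s" using real_sqrt_le_mono[of 4 s] by simp
    then show ?thesis using assms by linarith
  qed
  then have "(\<delta> / 3)\<^sup>2 \<le> \<bar>sqrt s - 1\<bar>\<^sup>2" using assms by (intro power_mono) auto
  then show ?thesis using two_ln_sqrt_bound[OF assms(1)] by (simp add: power_divide)
qed

text \<open>
  A weak form of Pinsker's inequality, by way of the Hellinger distance: the divergence dominates
  \<open>\<Sum>i. (\<surd>p\<^sub>i - \<surd>q\<^sub>i)\<^sup>2\<close> termwise, up to terms that cancel in the sum, and the Cauchy-Schwarz inequality compares this with
  the \<open>\<ell>\<^sub>1\<close> distance through \<open>p\<^sub>i - q\<^sub>i = (\<surd>p\<^sub>i - \<surd>q\<^sub>i)(\<surd>p\<^sub>i + \<surd>q\<^sub>i)\<close>.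
\<close>
lemma pinsker_quarter:
  fixes p q :: "'i \<Rightarrow> real"
  assumes pos: "\<And>i. i \<in> I \<Longrightarrow> 0 < p i" "\<And>i. i \<in> I \<Longrightarrow> 0 < q i"
    and p1: "(\<Sum>i\<in>I. p i) = 1" and q1: "(\<Sum>i\<in>I. q i) = 1"
  shows "(\<Sum>i\<in>I. \<bar>p i - q i\<bar>)\<^sup>2 \<le> 4 * (\<Sum>i\<in>I. p i * ln (p i / q i))"
proof -
  define H where "H = (\<Sum>i\<in>I. (sqrt (p i) - sqrt (q i))\<^sup>2)"
  have summand: "(sqrt (p i) - sqrt (q i))\<^sup>2 \<le> p i * ln (p i / q i) - p i + q i" if "i \<in> I" for i
  proof -
    have "p i * (sqrt (q i / p i) - 1)\<^sup>2 \<le> p i * (q i / p i - 1 - ln (q i / p i))"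
      using pos[OF that] by (intro mult_left_mono two_ln_sqrt_bound) auto
    moreover have "p i * (sqrt (q i / p i) - 1)\<^sup>2 = (sqrt (p i) - sqrt (q i))\<^sup>2"
    proof -
      have "(sqrt (p i) - sqrt (q i))\<^sup>2 = (sqrt (p i) * (1 - sqrt (q i / p i)))\<^sup>2"
        using pos[OF that] by (simp add: real_sqrt_divide right_diff_distrib)
      also have "\<dots> = p i * (sqrt (q i / p i) - 1)\<^sup>2"
        using pos[OF that] by (simp add: power_mult_distrib power2_commute)
      finally show ?thesis by simp
    qed
    ultimately show ?thesis
      using pos[OF that] by (simp add: ln_div algebra_simps)
  qed
  have "H \<le> (\<Sum>i\<in>I. p i * ln (p i / q i) - p i + q i)"
    unfolding H_def by (intro sum_mono summand)
  then have H: "H \<le> (\<Sum>i\<in>I. p i * ln (p i / q i))"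
    using p1 q1 by (simp add: sum.distrib sum_subtractf)
  have "(\<Sum>i\<in>I. \<bar>p i - q i\<bar>) = (\<Sum>i\<in>I. \<bar>sqrt (p i) - sqrt (q i)\<bar> * (sqrt (p i) + sqrt (q i)))"
  proof (intro sum.cong refl)
    fix i assume "i \<in> I"
    then have "p i - q i = (sqrt (p i) - sqrt (q i)) * (sqrt (p i) + sqrt (q i))"
      using pos[of i] by (simp add: algebra_simps)
    then show "\<bar>p i - q i\<bar> = \<bar>sqrt (p i) - sqrt (q i)\<bar> * (sqrt (p i) + sqrt (q i))"
      using pos[OF \<open>i \<in> I\<close>] by (simp add: abs_mult)
  qed
  then have "(\<Sum>i\<in>I. \<bar>p i - q i\<bar>)\<^sup>2
      \<le> (\<Sum>i\<in>I. \<bar>sqrt (p i) - sqrt (q i)\<bar>\<^sup>2) * (\<Sum>i\<in>I. (sqrt (p i) + sqrt (q i))\<^sup>2)"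
    using Cauchy_Schwarz_ineq_sum[of "\<lambda>i. \<bar>sqrt (p i) - sqrt (q i)\<bar>" "\<lambda>i. sqrt (p i) + sqrt (q i)" I]
    by simp
  also have "\<dots> = H * (\<Sum>i\<in>I. (sqrt (p i) + sqrt (q i))\<^sup>2)" by (simp add: H_def)
  also have "\<dots> \<le> H * 4"
  proof (intro mult_left_mono)
    have "(sqrt (p i) + sqrt (q i))\<^sup>2 \<le> 2 * p i + 2 * q i" if "i \<in> I" for i
      using pos[OF that] sum_squares_bound[of "sqrt (p i)" "sqrt (q i)"]
      by (simp add: power2_sum)
    then have "(\<Sum>i\<in>I. (sqrt (p i) + sqrt (q i))\<^sup>2) \<le> (\<Sum>i\<in>I. 2 * p i + 2 * q i)"
      by (intro sum_mono)
    then show "(\<Sum>i\<in>I. (sqrt (p i) + sqrt (q i))\<^sup>2) \<le> 4"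
      using p1 q1 by (simp add: sum.distrib flip: sum_distrib_left)
    show "0 \<le> H" unfolding H_def by (intro sum_nonneg) auto
  qed
  finally show ?thesis using H by simp
qed

text \<open>
  A form of Hoeffding's lemma. Small \<open>M\<close> allow the quadratic bound on the exponential; for large \<open>M\<close>
  the crude estimate \<open>u \<le> M \<le> 2M\<^sup>2 - M\<close> suffices, as the mean is at least \<open>-M\<close>.
\<close>
lemma exp_moment_bound:
  fixes p u :: "'i \<Rightarrow> real"
  assumes p0: "\<And>i. i \<in> I \<Longrightarrow> 0 \<le> p i" and p1: "(\<Sum>i\<in>I. p i) = 1"
    and u: "\<And>i. i \<in> I \<Longrightarrow> \<bar>u i\<bar> \<le> M"
  shows "(\<Sum>i\<in>I. p i * exp (u i)) \<le> exp ((\<Sum>i\<in>I. p i * u i) + 2 * M\<^sup>2)"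
proof -
  have "I \<noteq> {}" using p1 by auto
  then have M0: "0 \<le> M" using u by (meson abs_ge_zero all_not_in_conv order_trans)
  show ?thesis
  proof (cases "M \<le> 1")
    case True
    have "(\<Sum>i\<in>I. p i * exp (u i)) \<le> (\<Sum>i\<in>I. p i * (1 + u i + M\<^sup>2))"
    proof (intro sum_mono mult_left_mono p0)
      fix i assume "i \<in> I"
      then have "(u i)\<^sup>2 \<le> M\<^sup>2" using u[of i] power_mono[of "\<bar>u i\<bar>" M 2] by simp
      then show "exp (u i) \<le> 1 + u i + M\<^sup>2"
        using exp_le_quadratic[of "u i"] u[OF \<open>i \<in> I\<close>] True by linarith
    qed auto
    also have "\<dots> = (\<Sum>i\<in>I. p i) + (\<Sum>i\<in>I. p i * u i) + (\<Sum>i\<in>I. p i) * M\<^sup>2"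
      by (simp add: distrib_left sum.distrib sum_distrib_right)
    also have "\<dots> \<le> 1 + ((\<Sum>i\<in>I. p i * u i) + 2 * M\<^sup>2)" using p1 by simp
    also have "\<dots> \<le> exp ((\<Sum>i\<in>I. p i * u i) + 2 * M\<^sup>2)" by (rule exp_ge_add_one_self)
    finally show ?thesis .
  next
    case False
    have "(\<Sum>i\<in>I. p i * exp (u i)) \<le> (\<Sum>i\<in>I. p i * exp M)"
      using u by (intro sum_mono mult_left_mono p0) (auto dest: abs_le_D1)
    also have "\<dots> = exp M" using p1 by (simp flip: sum_distrib_right)
    also have "\<dots> \<le> exp ((\<Sum>i\<in>I. p i * u i) + 2 * M\<^sup>2)"
    proof -
      have "(\<Sum>i\<in>I. p i * (- M)) \<le> (\<Sum>i\<in>I. p i * u i)"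
        using u by (intro sum_mono mult_left_mono p0) (auto simp: abs_le_iff minus_le_iff)
      then have "- M \<le> (\<Sum>i\<in>I. p i * u i)" using p1 by (simp only: flip: sum_distrib_right)
      moreover have "M \<le> M\<^sup>2" using False by (simp add: power2_eq_square)
      ultimately show ?thesis by simp
    qed
    finally show ?thesis .
  qed
qed

text \<open>
  The gain in one inequality multiplier, with weight \<open>w = exp (- \<eta> a\<^sub>k - 1)\<close> and \<open>p = P \<cdot> D\<^sub>k\<close>; the term quadratic
  in \<open>\<delta>\<close> is the share of this coordinate in the Hoeffding bound. The derivative at \<open>\<delta> = 0\<close> is \<open>d = w - p\<close>, so the
  step goes in the direction of \<open>d\<close>. Because \<open>w\<close> has no upper bound other than \<open>\<bar>d\<bar> + c\<close>, the curvature \<open>\<eta> w\<close>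
  consists of a part \<open>\<eta> \<bar>d\<bar>\<close>, which the first argument of the minimum controls, and a bounded part,
  which the second one controls.
\<close>
lemma inequality_coordinate_gain:
  fixes \<eta> w p c N :: real
  assumes eta: "0 < \<eta>" and w: "0 < w" and p: "\<bar>p\<bar> \<le> c" and c: "0 < c" and N: "0 \<le> N"
  shows "\<exists>\<delta>. 1 / 4 * (\<bar>w - p\<bar> * min (1 / (8 * \<eta>)) (\<bar>w - p\<bar> / (8 * \<eta> * c + 4 * \<eta> * N * c\<^sup>2)))
     \<le> w * (1 - exp (- \<eta> * \<delta>)) / \<eta> - \<delta> * p - 2 * \<eta> * N * c\<^sup>2 * \<delta>\<^sup>2"
proof -
  define d where "d = w - p"
  define \<beta> where "\<beta> = 8 * \<eta> * c + 4 * \<eta> * N * c\<^sup>2"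
  have \<beta>: "0 < \<beta>" unfolding \<beta>_def using eta c N by (intro add_pos_nonneg) auto
  have \<beta>_half: "\<beta> / 2 = 4 * (\<eta> * c) + 2 * (\<eta> * (N * c\<^sup>2))"
    by (simp add: \<beta>_def)
  define m where "m = min (1 / (8 * \<eta>)) (\<bar>d\<bar> / \<beta>)"
  have m0: "0 \<le> m" and m1: "m * \<eta> \<le> 1 / 8" and m2: "m * \<beta> \<le> \<bar>d\<bar>"
    using eta \<beta> by (auto simp: m_def min_def field_simps)
  \<comment> \<open>The maximiser of the quadratic model, up to constants, capped so that \<open>\<eta> \<delta>\<close> stays small.\<close>
  define \<delta> where "\<delta> = sgn d * m / 2"
  have \<delta>d: "\<delta> * d = \<bar>d\<bar> * m / 2" by (simp add: \<delta>_def abs_sgn mult_ac)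
  have abs\<delta>: "\<bar>\<delta>\<bar> \<le> m / 2" using m0 by (simp add: \<delta>_def abs_mult abs_sgn_eq)
  have \<delta>2: "\<delta>\<^sup>2 \<le> (m / 2)\<^sup>2" using power_mono[OF abs\<delta>, of 2] by simp
  have "exp (- \<eta> * \<delta>) \<le> 1 + (- \<eta> * \<delta>) + (- \<eta> * \<delta>)\<^sup>2"
  proof (rule exp_le_quadratic)
    have "\<bar>- \<eta> * \<delta>\<bar> \<le> \<eta> * (m / 2)" using eta abs\<delta> by (simp add: abs_mult)
    also have "\<dots> \<le> 1" using m1 by (simp add: mult.commute)
    finally show "\<bar>- \<eta> * \<delta>\<bar> \<le> 1" .
  qed
  then have "\<eta> * (\<delta> - \<eta> * \<delta>\<^sup>2) \<le> 1 - exp (- \<eta> * \<delta>)"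
    by (simp add: algebra_simps power2_eq_square)
  then have "w * (\<eta> * (\<delta> - \<eta> * \<delta>\<^sup>2)) / \<eta> \<le> w * (1 - exp (- \<eta> * \<delta>)) / \<eta>"
    using w eta by (intro divide_right_mono mult_left_mono) auto
  then have "w * (\<delta> - \<eta> * \<delta>\<^sup>2) \<le> w * (1 - exp (- \<eta> * \<delta>)) / \<eta>"
    using eta by simp
  then have lower: "w * (1 - exp (- \<eta> * \<delta>)) / \<eta> - \<delta> * p - 2 * \<eta> * N * c\<^sup>2 * \<delta>\<^sup>2
     \<ge> \<delta> * d - \<eta> * (w + 2 * N * c\<^sup>2) * \<delta>\<^sup>2" (is "?g \<ge> _")
    by (simp add: d_def algebra_simps)
  have "\<eta> * (w + 2 * N * c\<^sup>2) * \<delta>\<^sup>2 \<le> (\<eta> * \<bar>d\<bar> + \<beta> / 2) * (m / 2)\<^sup>2"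
  proof (intro mult_mono \<delta>2)
    have "w \<le> \<bar>d\<bar> + c" using p by (simp add: d_def)
    then have "\<eta> * w \<le> \<eta> * (\<bar>d\<bar> + c)" using eta by simp
    moreover have "0 \<le> \<eta> * c" using eta c by simp
    ultimately show "\<eta> * (w + 2 * N * c\<^sup>2) \<le> \<eta> * \<bar>d\<bar> + \<beta> / 2"
      unfolding \<beta>_half by (simp add: distrib_left mult.assoc mult.left_commute)
    show "0 \<le> \<eta> * \<bar>d\<bar> + \<beta> / 2" using eta \<beta> by (intro add_nonneg_nonneg) auto
  qed auto
  also have "(\<eta> * \<bar>d\<bar> + \<beta> / 2) * (m / 2)\<^sup>2 = (2 * ((m * \<eta>) * (\<bar>d\<bar> * m)) + (m * \<beta>) * m) / 8"
    by (simp add: power2_eq_square algebra_simps)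
  also have "\<dots> \<le> (2 * (1 / 8 * (\<bar>d\<bar> * m)) + \<bar>d\<bar> * m) / 8"
    using m0 by (intro divide_right_mono add_mono mult_left_mono mult_right_mono m1 m2) auto
  also have "\<dots> \<le> \<bar>d\<bar> * m / 4" using m0 by simp
  finally have "\<eta> * (w + 2 * N * c\<^sup>2) * \<delta>\<^sup>2 \<le> \<bar>d\<bar> * m / 4" .
  moreover have "1 / 4 * X \<le> G" if "X / 2 - Y \<le> G" "Y \<le> X / 4" for X Y G :: real
    using that by linarith
  ultimately have "1 / 4 * (\<bar>d\<bar> * m) \<le> ?g" using lower unfolding \<delta>d by blast
  then show ?thesis unfolding m_def \<beta>_def d_def by blast
qed

text \<open>
  The gain in one equality multiplier, whose objective is a quadratic polynomial: the witness is its maximiser.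
\<close>
lemma equality_coordinate_gain:
  fixes \<eta> p c N :: real
  assumes "0 < \<eta>" "0 < c" "0 < N"
  shows "\<exists>\<delta>. 1 / 4 * (p\<^sup>2 / (2 * \<eta> * N * c\<^sup>2)) \<le> - \<delta> * p - 2 * \<eta> * N * c\<^sup>2 * \<delta>\<^sup>2"
  by (rule exI[of _ "- p / (4 * \<eta> * N * c\<^sup>2)"])
    (use assms in \<open>simp add: field_simps power2_eq_square\<close>)

section \<open>Norms of vectors and matrices\<close>

lemma sum_lessThan_add:
  fixes g :: "nat \<Rightarrow> real"
  shows "(\<Sum>i<m + k. g i) = (\<Sum>i<m. g i) + (\<Sum>i<k. g (m + i))"
  by (induction k) simp_all

lemma l1_norm_append: "l1_norm (u @\<^sub>v v) = l1_norm u + l1_norm v"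
  by (simp add: l1_norm_def sum_lessThan_add)

lemma entry_le_max_norm:
  assumes "M \<in> carrier_mat n k" "i < n" "j < k"
  shows "\<bar>M $$ (i, j)\<bar> \<le> max_norm M"
  unfolding max_norm_def
proof (rule Max_ge)
  have "{\<bar>M $$ (i, j)\<bar> | i j. i < dim_row M \<and> j < dim_col M}
      = (\<lambda>(i, j). \<bar>M $$ (i, j)\<bar>) ` ({..<dim_row M} \<times> {..<dim_col M})" by auto
  then show "finite {\<bar>M $$ (i, j)\<bar> | i j. i < dim_row M \<and> j < dim_col M}" by simp
  show "\<bar>M $$ (i, j)\<bar> \<in> {\<bar>M $$ (i, j)\<bar> | i j. i < dim_row M \<and> j < dim_col M}"
    using assms by auto
qed

section \<open>The dual problem\<close>

locale dual_problem =
  fixes \<eta> :: real and n K L :: nat and C :: "real mat" and D :: "nat \<Rightarrow> real mat" and r c :: "real vec"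
  assumes eta_pos: "0 < \<eta>"
    and D_carrier: "m < K + L \<Longrightarrow> D m \<in> carrier_mat n n"
    and density_r: "density n r" and density_c: "density n c"
begin

abbreviation f :: "dual \<Rightarrow> real" where "f \<equiv> lyapunov \<eta> n K L C D r c"
abbreviation P :: "dual \<Rightarrow> real mat" where "P \<equiv> assoc_mat \<eta> n K L C D"
abbreviation Qx :: "dual \<Rightarrow> real" where "Qx \<equiv> Q_x \<eta> n K L C D r"
abbreviation Qy :: "dual \<Rightarrow> real" where "Qy \<equiv> Q_y \<eta> n K L C D c"
abbreviation Qa :: "dual \<Rightarrow> real" where "Qa \<equiv> Q_a \<eta> n K L C D"
abbreviation cd :: real where "cd \<equiv> c_d K L D"

definition row_sum :: "dual \<Rightarrow> nat \<Rightarrow> real" where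
  "row_sum z i = (\<Sum>j<n. P z $$ (i, j))"

definition col_sum :: "dual \<Rightarrow> nat \<Rightarrow> real" where
  "col_sum z j = (\<Sum>i<n. P z $$ (i, j))"

definition mass :: "dual \<Rightarrow> real" where
  "mass z = (\<Sum>i<n. \<Sum>j<n. P z $$ (i, j))"

definition weight :: "dual \<Rightarrow> nat \<Rightarrow> real" where
  "weight z k = exp (- \<eta> * snd (snd z) $ k - 1)"

text \<open>
  The quantities \<open>d\<^sub>m\<close> of both kinds of constraints, under one index. They are the partial derivatives
  of \<open>f\<close> in the multipliers (\<open>l1_norm_gradient\<close>).
\<close>
definition slack :: "dual \<Rightarrow> nat \<Rightarrow> real" where
  "slack z m = (if m < K then weight z m else 0) - mat_dot (P z) (D m)"

text \<open>
  The \<open>\<ell>\<^sub>1\<close> norm of the gradient, with the derivatives worked out (\<open>l1_norm_gradient\<close>).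
\<close>
definition residual :: "dual \<Rightarrow> real" where
  "residual z = (\<Sum>i<n. \<bar>r $ i - row_sum z i\<bar>) + (\<Sum>j<n. \<bar>c $ j - col_sum z j\<bar>)
     + (\<Sum>m<K + L. \<bar>slack z m\<bar>)"

lemma P_dim [simp]: "dim_row (P z) = n" "dim_col (P z) = n"
  by (cases z; simp)+

lemma P_pos: "i < n \<Longrightarrow> j < n \<Longrightarrow> 0 < P z $$ (i, j)"
  by (cases z) simp

lemma r_sum: "(\<Sum>i<n. r $ i) = 1" and c_sum: "(\<Sum>j<n. c $ j) = 1"
  and r_carrier: "r \<in> carrier_vec n" and c_carrier: "c \<in> carrier_vec n"
  and r_nonneg: "i < n \<Longrightarrow> 0 \<le> r $ i" and c_nonneg: "i < n \<Longrightarrow> 0 \<le> c $ i"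
  using density_r density_c by (auto simp: density_def)

lemma n_pos: "0 < n"
  using r_sum by (cases n) auto

lemma mass_rows: "mass z = (\<Sum>i<n. row_sum z i)"
  by (simp add: mass_def row_sum_def)

lemma mass_cols: "mass z = (\<Sum>j<n. col_sum z j)"
  unfolding mass_def col_sum_def by (rule sum.swap)

lemma row_sum_pos: "i < n \<Longrightarrow> 0 < row_sum z i"
  unfolding row_sum_def using n_pos by (intro sum_pos) (auto intro: P_pos)

lemma col_sum_pos: "j < n \<Longrightarrow> 0 < col_sum z j"
  unfolding col_sum_def using n_pos by (intro sum_pos) (auto intro: P_pos)

lemma mass_pos: "0 < mass z"
  unfolding mass_rows using n_pos by (intro sum_pos) (auto intro: row_sum_pos)

lemma P_mult_ones: "i < n \<Longrightarrow> (P z *\<^sub>v ones n) $ i = row_sum z i"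
  by (simp add: ones_def row_sum_def scalar_prod_def lessThan_atLeast0)

lemma P_transpose_mult_ones: "j < n \<Longrightarrow> (transpose_mat (P z) *\<^sub>v ones n) $ j = col_sum z j"
  by (simp add: ones_def col_sum_def scalar_prod_def lessThan_atLeast0)

lemma Qx_eq: "Qx z = (\<Sum>i<n. r $ i * ln (r $ i / row_sum z i))"
  using r_carrier by (simp add: Q_x_def KL_def P_mult_ones del: index_mult_mat_vec)

lemma Qy_eq: "Qy z = (\<Sum>j<n. c $ j * ln (c $ j / col_sum z j))"
  using c_carrier by (simp add: Q_y_def KL_def P_transpose_mult_ones del: index_mult_mat_vec)

lemma d_ineq_eq: "k < K \<Longrightarrow> d_ineq \<eta> n K L C D z k = slack z k"
  by (cases z) (simp add: slack_def weight_def)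

lemma d_eq_eq: "d_eq \<eta> n K L C D z l = slack z (K + l)"
  by (simp add: slack_def d_eq_def)

lemma Qa_eq:
  "Qa z = (\<Sum>k<K. \<bar>slack z k\<bar> * min (1 / (8 * \<eta>))
        (\<bar>slack z k\<bar> / (8 * \<eta> * cd + 4 * \<eta> * real (K + L) * cd\<^sup>2)))
     + (\<Sum>l<L. (slack z (K + l))\<^sup>2 / (2 * \<eta> * real (K + L) * cd\<^sup>2))"
  unfolding Q_a_def d_eq_eq by (simp add: d_ineq_eq)

lemma D_entry_le:
  assumes "m < K + L" "i < n" "j < n"
  shows "\<bar>D m $$ (i, j)\<bar> \<le> cd"
proof -
  have "\<bar>D m $$ (i, j)\<bar> \<le> max_norm (D m)" using D_carrier assms by (intro entry_le_max_norm)
  also have "\<dots> \<le> cd" unfolding c_d_def using assms by (intro Max_ge) auto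
  finally show ?thesis .
qed

lemma cd_nonneg: "0 < K + L \<Longrightarrow> 0 \<le> cd"
  using order_trans[OF abs_ge_zero D_entry_le[of 0 0 0]] n_pos by simp

lemma P_dot_D_le:
  assumes "m < K + L"
  shows "\<bar>mat_dot (P z) (D m)\<bar> \<le> mass z * cd"
proof -
  have "\<bar>mat_dot (P z) (D m)\<bar> \<le> (\<Sum>i<n. \<Sum>j<n. \<bar>P z $$ (i, j) * D m $$ (i, j)\<bar>)"
    unfolding mat_dot_def by (simp, intro order_trans[OF sum_abs] sum_mono sum_abs)
  also have "\<dots> \<le> (\<Sum>i<n. \<Sum>j<n. P z $$ (i, j) * cd)"
  proof (intro sum_mono)
    fix i j assume "i \<in> {..<n}" "j \<in> {..<n}"
    then show "\<bar>P z $$ (i, j) * D m $$ (i, j)\<bar> \<le> P z $$ (i, j) * cd"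
      using D_entry_le[OF assms, of i j] P_pos[of i j z] by (simp add: abs_mult)
  qed
  also have "\<dots> = mass z * cd" by (simp add: mass_def sum_distrib_right)
  finally show ?thesis .
qed

section \<open>Increments and derivatives of the Lyapunov function\<close>

text \<open>
  Relative to a base point, the exponentials in \<open>f\<close> become \<open>P\<close> times the exponential of the displacement.
  The derivatives, the gains and the effect of normalisation are all read off from this formula.
\<close>
lemma f_increment:
  "f (x', y', a') - f (x, y, a) =
     1 / \<eta> * (\<Sum>i<n. \<Sum>j<n. P (x, y, a) $$ (i, j) *
        (1 - exp (\<eta> * ((\<Sum>m<K + L. (a' $ m - a $ m) * D m $$ (i, j)) + (x' $ i - x $ i) + (y' $ j - y $ j)))))
     + (\<Sum>i<n. (x' $ i - x $ i) * r $ i) + (\<Sum>j<n. (y' $ j - y $ j) * c $ j)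
     + 1 / \<eta> * (\<Sum>k<K. weight (x, y, a) k * (1 - exp (- \<eta> * (a' $ k - a $ k))))"
proof -
  define E where "E x y a i j =
    exp (\<eta> * (- C $$ (i, j) + (\<Sum>m<K + L. a $ m * D m $$ (i, j)) + x $ i + y $ j) - 1)"
    for x y a :: "real vec" and i j
  have E': "E x' y' a' i j = P (x, y, a) $$ (i, j) *
        exp (\<eta> * ((\<Sum>m<K + L. (a' $ m - a $ m) * D m $$ (i, j)) + (x' $ i - x $ i) + (y' $ j - y $ j)))"
    if "i < n" "j < n" for i j
  proof -
    define S S' where "S = (\<Sum>m<K + L. a $ m * D m $$ (i, j))"
      and "S' = (\<Sum>m<K + L. a' $ m * D m $$ (i, j))"
    have "(\<Sum>m<K + L. (a' $ m - a $ m) * D m $$ (i, j)) = S' - S"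
      by (simp add: S_def S'_def left_diff_distrib sum_subtractf)
    moreover have "P (x, y, a) $$ (i, j) = exp (\<eta> * (- C $$ (i, j) + S + x $ i + y $ j) - 1)"
      using that by (simp add: S_def)
    moreover have "\<eta> * (- C $$ (i, j) + S' + x' $ i + y' $ j) - 1 = (\<eta> * (- C $$ (i, j) + S + x $ i + y $ j) - 1)
        + \<eta> * (S' - S + (x' $ i - x $ i) + (y' $ j - y $ j))"
      by (simp add: algebra_simps)
    ultimately show ?thesis by (simp only: E_def S'_def[symmetric] exp_add)
  qed
  have P: "P (x, y, a) $$ (i, j) = E x y a i j" if "i < n" "j < n" for i j
    using that by (simp add: E_def)
  have W: "exp (- \<eta> * a' $ k - 1) = weight (x, y, a) k * exp (- \<eta> * (a' $ k - a $ k))" for k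
    unfolding weight_def exp_add[symmetric] by (rule arg_cong[where f = exp]) (simp add: algebra_simps)
  have f: "f (x, y, a) = - (1 / \<eta>) * (\<Sum>i<n. \<Sum>j<n. E x y a i j)
     + (\<Sum>i<n. x $ i * r $ i) + (\<Sum>j<n. y $ j * c $ j)
     - (1 / \<eta>) * (\<Sum>k<K. exp (- \<eta> * a $ k - 1))" for x y a
    by (simp only: lyapunov.simps E_def)
  have "(\<Sum>i<n. \<Sum>j<n. P (x, y, a) $$ (i, j) *
        (1 - exp (\<eta> * ((\<Sum>m<K + L. (a' $ m - a $ m) * D m $$ (i, j)) + (x' $ i - x $ i) + (y' $ j - y $ j)))))
      = (\<Sum>i<n. \<Sum>j<n. E x y a i j - E x' y' a' i j)"
    by (intro sum.cong refl) (simp add: E' P right_diff_distrib del: assoc_mat.simps)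
  moreover have "(\<Sum>k<K. weight (x, y, a) k * (1 - exp (- \<eta> * (a' $ k - a $ k))))
      = (\<Sum>k<K. exp (- \<eta> * a $ k - 1) - exp (- \<eta> * a' $ k - 1))"
    by (intro sum.cong refl) (simp only: W right_diff_distrib mult_1_right, simp add: weight_def)
  ultimately show ?thesis
    unfolding f sum_subtractf left_diff_distrib by (simp only: right_diff_distrib)
qed

declare lyapunov.simps [simp del] assoc_mat.simps [simp del]

lemma f_increment_x:
  "f (x', y, a) - f (x, y, a) =
     1 / \<eta> * (\<Sum>i<n. row_sum (x, y, a) i * (1 - exp (\<eta> * (x' $ i - x $ i)))) + (\<Sum>i<n. (x' $ i - x $ i) * r $ i)"
  unfolding f_increment by (simp add: row_sum_def sum_distrib_right)

lemma f_increment_y: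
  "f (x, y', a) - f (x, y, a) =
     1 / \<eta> * (\<Sum>j<n. col_sum (x, y, a) j * (1 - exp (\<eta> * (y' $ j - y $ j)))) + (\<Sum>j<n. (y' $ j - y $ j) * c $ j)"
  unfolding f_increment
  by (simp add: col_sum_def sum_distrib_right) (rule disjI2, rule sum.swap)

lemma f_increment_shift_a:
  assumes "x \<in> carrier_vec n"
  shows "f (x + t \<cdot>\<^sub>v ones n, y, a') - f (x, y, a) =
     1 / \<eta> * (\<Sum>i<n. \<Sum>j<n. P (x, y, a) $$ (i, j) *
        (1 - exp (\<eta> * t) * exp (\<eta> * (\<Sum>m<K + L. (a' $ m - a $ m) * D m $$ (i, j)))))
     + t + 1 / \<eta> * (\<Sum>k<K. weight (x, y, a) k * (1 - exp (- \<eta> * (a' $ k - a $ k))))"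
proof -
  have "(x + t \<cdot>\<^sub>v ones n) $ i - x $ i = t" if "i < n" for i
    using assms that by (simp add: ones_def)
  then show ?thesis
    unfolding f_increment
    by (simp add: distrib_left exp_add mult.commute[of "exp (\<eta> * t)"] r_sum
        sum_distrib_left[symmetric])
qed

lemma f_x_direction:
  assumes "x \<in> carrier_vec n" "i < n"
  shows "f (x + s \<cdot>\<^sub>v unit_vec n i, y, a) =
    f (x, y, a) + (1 / \<eta> * (row_sum (x, y, a) i * (1 - exp (\<eta> * s))) + s * r $ i)"
proof -
  have d: "(x + s \<cdot>\<^sub>v unit_vec n i) $ k - x $ k = (if k = i then s else 0)" if "k < n" for k
    using assms that by simp
  have "f (x + s \<cdot>\<^sub>v unit_vec n i, y, a) - f (x, y, a) =
      1 / \<eta> * (\<Sum>k<n. if k = i then row_sum (x, y, a) k * (1 - exp (\<eta> * s)) else 0)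
      + (\<Sum>k<n. if k = i then s * r $ k else 0)"
    unfolding f_increment_x
    by (intro arg_cong2[where f = "(+)"] arg_cong2[where f = "(*)"] refl sum.cong) (auto simp: d simp del: index_add_vec index_smult_vec)
  then show ?thesis using assms by simp
qed

lemma f_y_direction:
  assumes "y \<in> carrier_vec n" "j < n"
  shows "f (x, y + s \<cdot>\<^sub>v unit_vec n j, a) =
    f (x, y, a) + (1 / \<eta> * (col_sum (x, y, a) j * (1 - exp (\<eta> * s))) + s * c $ j)"
proof -
  have d: "(y + s \<cdot>\<^sub>v unit_vec n j) $ k - y $ k = (if k = j then s else 0)" if "k < n" for k
    using assms that by simp
  have "f (x, y + s \<cdot>\<^sub>v unit_vec n j, a) - f (x, y, a) =
      1 / \<eta> * (\<Sum>k<n. if k = j then col_sum (x, y, a) k * (1 - exp (\<eta> * s)) else 0)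
      + (\<Sum>k<n. if k = j then s * c $ k else 0)"
    unfolding f_increment_y
    by (intro arg_cong2[where f = "(+)"] arg_cong2[where f = "(*)"] refl sum.cong) (auto simp: d simp del: index_add_vec index_smult_vec)
  then show ?thesis using assms by simp
qed

lemma f_a_direction:
  assumes "a \<in> carrier_vec (K + L)" "m < K + L"
  shows "f (x, y, a + s \<cdot>\<^sub>v unit_vec (K + L) m) =
    f (x, y, a) + (1 / \<eta> * (\<Sum>i<n. \<Sum>j<n. P (x, y, a) $$ (i, j) * (1 - exp (\<eta> * (s * D m $$ (i, j)))))
      + 1 / \<eta> * (if m < K then weight (x, y, a) m * (1 - exp (- \<eta> * s)) else 0))"
proof -
  have d: "(a + s \<cdot>\<^sub>v unit_vec (K + L) m) $ k - a $ k = (if k = m then s else 0)" if "k < K + L" for k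
    using assms that by simp
  have D: "(\<Sum>k<K + L. ((a + s \<cdot>\<^sub>v unit_vec (K + L) m) $ k - a $ k) * D k $$ (i, j)) = s * D m $$ (i, j)" for i j
  proof -
    have "(\<Sum>k<K + L. ((a + s \<cdot>\<^sub>v unit_vec (K + L) m) $ k - a $ k) * D k $$ (i, j))
       = (\<Sum>k<K + L. if k = m then s * D k $$ (i, j) else 0)"
      by (intro sum.cong refl) (auto simp: d simp del: index_add_vec index_smult_vec)
    then show ?thesis using assms by simp
  qed
  have W: "(\<Sum>k<K. weight (x, y, a) k * (1 - exp (- \<eta> * ((a + s \<cdot>\<^sub>v unit_vec (K + L) m) $ k - a $ k))))
      = (if m < K then weight (x, y, a) m * (1 - exp (- \<eta> * s)) else 0)"
  proof -
    have "(\<Sum>k<K. weight (x, y, a) k * (1 - exp (- \<eta> * ((a + s \<cdot>\<^sub>v unit_vec (K + L) m) $ k - a $ k))))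
      = (\<Sum>k<K. if k = m then weight (x, y, a) k * (1 - exp (- \<eta> * s)) else 0)"
      by (intro sum.cong refl) (auto simp: d simp del: index_add_vec index_smult_vec)
    then show ?thesis by simp
  qed
  have "f (x, y, a + s \<cdot>\<^sub>v unit_vec (K + L) m) - f (x, y, a) =
     1 / \<eta> * (\<Sum>i<n. \<Sum>j<n. P (x, y, a) $$ (i, j) * (1 - exp (\<eta> * (s * D m $$ (i, j)))))
      + 1 / \<eta> * (if m < K then weight (x, y, a) m * (1 - exp (- \<eta> * s)) else 0)"
    unfolding f_increment D W by simp
  then show ?thesis by simp
qed

lemma l1_norm_gradient:
  assumes "z \<in> dual_space n K L"
  shows "l1_norm (gradient n K L f z) = residual z"
proof -
  obtain x y a where z: "z = (x, y, a)" and x: "x \<in> carrier_vec n" and y: "y \<in> carrier_vec n"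
    and a: "a \<in> carrier_vec (K + L)"
    using assms by (auto simp: dual_space_def)
  have dx: "deriv (\<lambda>s. f (x + s \<cdot>\<^sub>v unit_vec n i, y, a)) 0 = r $ i - row_sum z i" if "i < n" for i
    unfolding f_x_direction[OF x that] z
    by (rule DERIV_imp_deriv) (use eta_pos in \<open>auto intro!: derivative_eq_intros\<close>)
  have dy: "deriv (\<lambda>s. f (x, y + s \<cdot>\<^sub>v unit_vec n j, a)) 0 = c $ j - col_sum z j" if "j < n" for j
    unfolding f_y_direction[OF y that] z
    by (rule DERIV_imp_deriv) (use eta_pos in \<open>auto intro!: derivative_eq_intros\<close>)
  have da: "deriv (\<lambda>s. f (x, y, a + s \<cdot>\<^sub>v unit_vec (K + L) m)) 0 = slack z m" if "m < K + L" for m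
  proof -
    have "((\<lambda>s. f (x, y, a) + (1 / \<eta> * (\<Sum>i<n. \<Sum>j<n. P z $$ (i, j) * (1 - exp (\<eta> * (s * D m $$ (i, j)))))
        + 1 / \<eta> * (if m < K then weight z m * (1 - exp (- \<eta> * s)) else 0)))
        has_field_derivative
        1 / \<eta> * (\<Sum>i<n. \<Sum>j<n. - (\<eta> * (P z $$ (i, j) * D m $$ (i, j))))
          + 1 / \<eta> * (if m < K then weight z m * \<eta> else 0)) (at 0)"
      using eta_pos by (cases "m < K") (auto intro!: derivative_eq_intros simp: mult_ac)
    moreover have "1 / \<eta> * (\<Sum>i<n. \<Sum>j<n. - (\<eta> * (P z $$ (i, j) * D m $$ (i, j))))
          + 1 / \<eta> * (if m < K then weight z m * \<eta> else 0) = slack z m"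
      using eta_pos by (simp add: slack_def mat_dot_def sum_negf flip: sum_distrib_left)
    ultimately show ?thesis
      unfolding f_a_direction[OF a that] z by (simp add: DERIV_imp_deriv)
  qed
  show ?thesis
    unfolding z gradient.simps l1_norm_append residual_def
    by (simp add: l1_norm_def dx dy da del: index_add_vec index_smult_vec flip: z)
qed

section \<open>Normalisation of the mass, and the updates\<close>

text \<open>
  Adding \<open>t\<close> to every entry of \<open>x\<close> multiplies \<open>P\<close> by \<open>exp (\<eta> t)\<close>, so only the mass of \<open>P\<close> enters.
\<close>
lemma f_shift:
  assumes "x \<in> carrier_vec n"
  shows "f (x + t \<cdot>\<^sub>v ones n, y, a) = f (x, y, a) + (mass (x, y, a) * (1 - exp (\<eta> * t)) / \<eta> + t)"
proof -
  have "f (x + t \<cdot>\<^sub>v ones n, y, a) - f (x, y, a) = mass (x, y, a) * (1 - exp (\<eta> * t)) / \<eta> + t"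
    unfolding f_increment_shift_a[OF assms]
    by (simp add: mass_def sum_distrib_right)
  then show ?thesis by simp
qed

lemma f_shift_y:
  assumes "y \<in> carrier_vec n"
  shows "f (x, y + t \<cdot>\<^sub>v ones n, a) = f (x, y, a) + (mass (x, y, a) * (1 - exp (\<eta> * t)) / \<eta> + t)"
proof -
  have "(y + t \<cdot>\<^sub>v ones n) $ j - y $ j = t" if "j < n" for j
    using assms that by (simp add: ones_def)
  then have "f (x, y + t \<cdot>\<^sub>v ones n, a) - f (x, y, a) = mass (x, y, a) * (1 - exp (\<eta> * t)) / \<eta> + t"
    unfolding f_increment_y mass_cols
    by (simp add: c_sum sum_distrib_left[symmetric] sum_distrib_right[symmetric])
  then show ?thesis by simp
qed

text \<open>
  The shift \<open>t = - ln (mass z) / \<eta>\<close> brings the mass to 1; this is its gain.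
\<close>
lemma log_mass_shift:
  "mass z * (1 - exp (\<eta> * (- ln (mass z) / \<eta>))) / \<eta> + (- ln (mass z) / \<eta>) = (mass z - 1 - ln (mass z)) / \<eta>"
  using eta_pos mass_pos[of z] by (simp add: exp_minus field_simps)

text \<open>
  At a maximiser in the direction of the shifts the normalising shift gains nothing, and
  \<open>s - 1 - ln s = 0\<close> only for \<open>s = 1\<close>.
\<close>
lemma mass_one_of_shift_maximal:
  assumes "\<And>t. mass z * (1 - exp (\<eta> * t)) / \<eta> + t \<le> 0"
  shows "mass z = 1"
proof -
  have "(mass z - 1 - ln (mass z)) / \<eta> \<le> 0"
    using assms[of "- ln (mass z) / \<eta>"] unfolding log_mass_shift .
  then have "mass z - 1 \<le> ln (mass z)" using eta_pos by (simp add: divide_le_0_iff)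
  then show ?thesis
    using ln_le_minus_one[OF mass_pos] ln_eq_minus_one[OF mass_pos] by (simp add: order_antisym)
qed

lemma ones_carrier [simp]: "ones n \<in> carrier_vec n"
  by (simp add: ones_def)

lemma shift_shift:
  assumes "x \<in> carrier_vec n"
  shows "(x + s \<cdot>\<^sub>v ones n) + t \<cdot>\<^sub>v ones n = x + (s + t) \<cdot>\<^sub>v ones n"
  using assms by (auto simp: ones_def algebra_simps)

text \<open>
  For this and the other two kinds of updates: the new point is an admissible point of mass 1, and it is at least as good
  as every competitor in its block.
\<close>
lemma x_update_dest:
  assumes "x_update n f (x, y, a) z'" "(x, y, a) \<in> dual_space n K L"
  shows "z' \<in> dual_space n K L" and "mass z' = 1"
    and "\<xi> \<in> carrier_vec n \<Longrightarrow> f (\<xi>, y, a) \<le> f z'"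
proof -
  obtain x' where z': "z' = (x', y, a)" and x': "x' \<in> carrier_vec n"
    and max: "\<And>\<xi>. \<xi> \<in> carrier_vec n \<Longrightarrow> f (\<xi>, y, a) \<le> f (x', y, a)"
    using assms(1) by (cases z') (auto simp: is_arg_max_def not_less)
  show "z' \<in> dual_space n K L" using x' z' assms(2) by (simp add: dual_space_def)
  show "mass z' = 1"
  proof (rule mass_one_of_shift_maximal)
    fix t show "mass z' * (1 - exp (\<eta> * t)) / \<eta> + t \<le> 0"
      using max[of "x' + t \<cdot>\<^sub>v ones n"] x' unfolding f_shift[OF x'] z' by simp
  qed
  show "\<xi> \<in> carrier_vec n \<Longrightarrow> f (\<xi>, y, a) \<le> f z'" using max z' by simp
qed

lemma y_update_dest:
  assumes "y_update n f (x, y, a) z'" "(x, y, a) \<in> dual_space n K L"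
  shows "z' \<in> dual_space n K L" and "mass z' = 1"
    and "\<upsilon> \<in> carrier_vec n \<Longrightarrow> f (x, \<upsilon>, a) \<le> f z'"
proof -
  obtain y' where z': "z' = (x, y', a)" and y': "y' \<in> carrier_vec n"
    and max: "\<And>\<upsilon>. \<upsilon> \<in> carrier_vec n \<Longrightarrow> f (x, \<upsilon>, a) \<le> f (x, y', a)"
    using assms(1) by (cases z') (auto simp: is_arg_max_def not_less)
  show "z' \<in> dual_space n K L" using y' z' assms(2) by (simp add: dual_space_def)
  show "mass z' = 1"
  proof (rule mass_one_of_shift_maximal)
    fix t show "mass z' * (1 - exp (\<eta> * t)) / \<eta> + t \<le> 0"
      using max[of "y' + t \<cdot>\<^sub>v ones n"] y' unfolding f_shift_y[OF y'] z' by simp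
  qed
  show "\<upsilon> \<in> carrier_vec n \<Longrightarrow> f (x, \<upsilon>, a) \<le> f z'" using max z' by simp
qed

lemma a_update_dest:
  assumes "a_update n K L f (x, y, a) z'" "(x, y, a) \<in> dual_space n K L"
  shows "z' \<in> dual_space n K L" and "mass z' = 1"
    and "\<alpha> \<in> carrier_vec (K + L) \<Longrightarrow> f (x + t \<cdot>\<^sub>v ones n, y, \<alpha>) \<le> f z'"
proof -
  have x: "x \<in> carrier_vec n" using assms(2) by (simp add: dual_space_def)
  obtain t' a' where z': "z' = (x + t' \<cdot>\<^sub>v ones n, y, a')" and a': "a' \<in> carrier_vec (K + L)"
    and max: "\<And>\<alpha> t. \<alpha> \<in> carrier_vec (K + L) \<Longrightarrow> f (x + t \<cdot>\<^sub>v ones n, y, \<alpha>) \<le> f (x + t' \<cdot>\<^sub>v ones n, y, a')"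
    using assms(1) by (cases z') (auto simp: is_arg_max_def not_less)
  have x': "x + t' \<cdot>\<^sub>v ones n \<in> carrier_vec n" using x by simp
  show "z' \<in> dual_space n K L" using x' a' z' assms(2) by (simp add: dual_space_def)
  show "mass z' = 1"
  proof (rule mass_one_of_shift_maximal)
    fix t
    have "f ((x + t' \<cdot>\<^sub>v ones n) + t \<cdot>\<^sub>v ones n, y, a') \<le> f (x + t' \<cdot>\<^sub>v ones n, y, a')"
      unfolding shift_shift[OF x] by (rule max[OF a'])
    then show "mass z' * (1 - exp (\<eta> * t)) / \<eta> + t \<le> 0"
      unfolding f_shift[OF x'] z' by simp
  qed
  show "\<alpha> \<in> carrier_vec (K + L) \<Longrightarrow> f (x + t \<cdot>\<^sub>v ones n, y, \<alpha>) \<le> f z'" using max z' by simp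
qed

section \<open>Gains of the updates\<close>

text \<open>
  The Sinkhorn rescaling makes the row sums equal to \<open>r\<close>. The mass of \<open>P\<close> is 1 before and after, so only
  the linear term of \<open>f\<close> changes, and it changes by \<open>Q\<^sub>x / \<eta>\<close>.
\<close>
lemma x_step_gain:
  assumes "mass (x, y, a) = 1" and r_pos: "\<And>i. i < n \<Longrightarrow> 0 < r $ i"
  shows "\<exists>\<xi>\<in>carrier_vec n. f (x, y, a) + Qx (x, y, a) / \<eta> \<le> f (\<xi>, y, a)"
proof
  let ?z = "(x, y, a)"
  define \<xi> where "\<xi> = vec n (\<lambda>i. x $ i + ln (r $ i / row_sum ?z i) / \<eta>)"
  show "\<xi> \<in> carrier_vec n" by (simp add: \<xi>_def)
  have d: "\<xi> $ i - x $ i = ln (r $ i / row_sum ?z i) / \<eta>" if "i < n" for i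
    using that by (simp add: \<xi>_def)
  have "(\<Sum>i<n. row_sum ?z i * (1 - exp (\<eta> * (\<xi> $ i - x $ i)))) = (\<Sum>i<n. row_sum ?z i - r $ i)"
  proof (intro sum.cong refl)
    fix i assume "i \<in> {..<n}"
    then show "row_sum ?z i * (1 - exp (\<eta> * (\<xi> $ i - x $ i))) = row_sum ?z i - r $ i"
      using eta_pos r_pos[of i] row_sum_pos[of i ?z] by (simp add: d field_simps)
  qed
  also have "\<dots> = 0" using assms(1) by (simp add: sum_subtractf r_sum mass_rows)
  finally have "f (\<xi>, y, a) - f ?z = (\<Sum>i<n. (\<xi> $ i - x $ i) * r $ i)"
    unfolding f_increment_x by simp
  also have "\<dots> = Qx ?z / \<eta>"
    unfolding Qx_eq sum_divide_distrib by (intro sum.cong refl) (simp add: d)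
  finally show "f ?z + Qx ?z / \<eta> \<le> f (\<xi>, y, a)" by simp
qed

lemma y_step_gain:
  assumes "mass (x, y, a) = 1" and c_pos: "\<And>j. j < n \<Longrightarrow> 0 < c $ j"
  shows "\<exists>\<upsilon>\<in>carrier_vec n. f (x, y, a) + Qy (x, y, a) / \<eta> \<le> f (x, \<upsilon>, a)"
proof
  let ?z = "(x, y, a)"
  define \<upsilon> where "\<upsilon> = vec n (\<lambda>j. y $ j + ln (c $ j / col_sum ?z j) / \<eta>)"
  show "\<upsilon> \<in> carrier_vec n" by (simp add: \<upsilon>_def)
  have d: "\<upsilon> $ j - y $ j = ln (c $ j / col_sum ?z j) / \<eta>" if "j < n" for j
    using that by (simp add: \<upsilon>_def)
  have "(\<Sum>j<n. col_sum ?z j * (1 - exp (\<eta> * (\<upsilon> $ j - y $ j)))) = (\<Sum>j<n. col_sum ?z j - c $ j)"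
  proof (intro sum.cong refl)
    fix j assume "j \<in> {..<n}"
    then show "col_sum ?z j * (1 - exp (\<eta> * (\<upsilon> $ j - y $ j))) = col_sum ?z j - c $ j"
      using eta_pos c_pos[of j] col_sum_pos[of j ?z] by (simp add: d field_simps)
  qed
  also have "\<dots> = 0" using assms(1) by (simp add: sum_subtractf c_sum mass_cols)
  finally have "f (x, \<upsilon>, a) - f ?z = (\<Sum>j<n. (\<upsilon> $ j - y $ j) * c $ j)"
    unfolding f_increment_y by simp
  also have "\<dots> = Qy ?z / \<eta>"
    unfolding Qy_eq sum_divide_distrib by (intro sum.cong refl) (simp add: d)
  finally show "f ?z + Qy ?z / \<eta> \<le> f (x, \<upsilon>, a)" by simp
qed

text \<open>
  For an increment \<open>\<delta>\<close> of the multipliers the best shift is \<open>t = - ln S / \<eta>\<close>, where \<open>S\<close> is the mass that \<open>P\<close> would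
  have after the increment alone. As \<open>P\<close> is a probability distribution, \<open>S\<close> is an exponential moment with exponents
  of modulus at most \<open>\<eta> c\<^sub>d \<Sum>m. \<bar>\<delta>\<^sub>m\<bar>\<close>. Bounding the square of this sum by \<open>(K + L) \<Sum>m. \<delta>\<^sub>m\<^sup>2\<close> leaves a lower bound
  that is separable in the coordinates of \<open>\<delta>\<close>.
\<close>
lemma a_step_lower_bound:
  assumes x: "x \<in> carrier_vec n" and a: "a \<in> carrier_vec (K + L)" and mass: "mass (x, y, a) = 1"
  shows "\<exists>\<alpha>\<in>carrier_vec (K + L). \<exists>t. f (x, y, a)
      - (\<Sum>m<K + L. \<delta> m * mat_dot (P (x, y, a)) (D m))
      - (\<Sum>m<K + L. 2 * \<eta> * real (K + L) * cd\<^sup>2 * (\<delta> m)\<^sup>2)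
      + (\<Sum>k<K. weight (x, y, a) k * (1 - exp (- \<eta> * \<delta> k)) / \<eta>)
    \<le> f (x + t \<cdot>\<^sub>v ones n, y, \<alpha>)"
proof -
  let ?z = "(x, y, a)"
  define u where "u = (\<lambda>(i, j). \<eta> * (\<Sum>m<K + L. \<delta> m * D m $$ (i, j)))"
  define p where "p = (\<lambda>ij. P ?z $$ ij)"
  define I where "I = {..<n} \<times> {..<n}"
  define M where "M = \<eta> * cd * (\<Sum>m<K + L. \<bar>\<delta> m\<bar>)"
  have double: "(\<Sum>i<n. \<Sum>j<n. g (i, j)) = (\<Sum>ij\<in>I. g ij)" for g :: "nat \<times> nat \<Rightarrow> real"
    unfolding I_def by (simp add: sum.cartesian_product)
  have p_pos: "0 < p ij" if "ij \<in> I" for ij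
    using that P_pos by (auto simp: p_def I_def)
  have p_sum: "(\<Sum>ij\<in>I. p ij) = 1"
    using mass unfolding mass_def p_def by (simp only: double)
  have u_le: "\<bar>u ij\<bar> \<le> M" if ij_I: "ij \<in> I" for ij
  proof -
    obtain i j where ij: "ij = (i, j)" "i < n" "j < n" using ij_I by (auto simp: I_def)
    have "\<bar>\<Sum>m<K + L. \<delta> m * D m $$ (i, j)\<bar> \<le> (\<Sum>m<K + L. \<bar>\<delta> m\<bar> * cd)"
      using D_entry_le ij
      by (intro order_trans[OF sum_abs] sum_mono) (auto simp: abs_mult intro!: mult_left_mono)
    then have "\<eta> * \<bar>\<Sum>m<K + L. \<delta> m * D m $$ (i, j)\<bar> \<le> \<eta> * (\<Sum>m<K + L. \<bar>\<delta> m\<bar> * cd)"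
      using eta_pos by simp
    then show ?thesis
      using eta_pos by (simp add: u_def ij abs_mult M_def flip: sum_distrib_right) (simp add: mult_ac)
  qed
  define S where "S = (\<Sum>ij\<in>I. p ij * exp (u ij))"
  have S_pos: "0 < S"
    unfolding S_def using n_pos p_pos by (intro sum_pos) (auto simp: I_def)
  have "S \<le> exp ((\<Sum>ij\<in>I. p ij * u ij) + 2 * M\<^sup>2)"
    unfolding S_def using p_pos p_sum u_le by (intro exp_moment_bound) (auto intro: less_imp_le)
  then have ln_S: "ln S \<le> (\<Sum>ij\<in>I. p ij * u ij) + 2 * M\<^sup>2"
    using S_pos by (metis ln_exp ln_le_cancel_iff exp_gt_zero)
  have mean: "(\<Sum>ij\<in>I. p ij * u ij) = \<eta> * (\<Sum>m<K + L. \<delta> m * mat_dot (P ?z) (D m))"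
  proof -
    have "(\<Sum>ij\<in>I. p ij * u ij) = (\<Sum>ij\<in>I. \<Sum>m<K + L. \<eta> * (\<delta> m * (p ij * D m $$ ij)))"
      by (intro sum.cong refl) (auto simp: u_def sum_distrib_left mult_ac)
    also have "\<dots> = (\<Sum>m<K + L. \<Sum>ij\<in>I. \<eta> * (\<delta> m * (p ij * D m $$ ij)))" by (rule sum.swap)
    also have "\<dots> = (\<Sum>m<K + L. \<eta> * (\<delta> m * (\<Sum>ij\<in>I. p ij * D m $$ ij)))"
      by (simp add: sum_distrib_left)
    also have "\<dots> = \<eta> * (\<Sum>m<K + L. \<delta> m * mat_dot (P ?z) (D m))"
      unfolding double[symmetric] mat_dot_def p_def by (simp add: sum_distrib_left)
    finally show ?thesis .
  qed
  have M2: "M\<^sup>2 \<le> \<eta> * (\<Sum>m<K + L. \<eta> * real (K + L) * cd\<^sup>2 * (\<delta> m)\<^sup>2)"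
  proof -
    have "(\<Sum>m<K + L. \<bar>\<delta> m\<bar>)\<^sup>2 \<le> real (K + L) * (\<Sum>m<K + L. (\<delta> m)\<^sup>2)"
      using sum_squared_le_sum_of_squares[of "\<lambda>m. \<bar>\<delta> m\<bar>" "{..<K + L}"] by (simp add: mult.commute)
    then have "(\<eta> * cd)\<^sup>2 * (\<Sum>m<K + L. \<bar>\<delta> m\<bar>)\<^sup>2 \<le> (\<eta> * cd)\<^sup>2 * (real (K + L) * (\<Sum>m<K + L. (\<delta> m)\<^sup>2))"
      by (intro mult_left_mono) auto
    then show ?thesis
      unfolding M_def power_mult_distrib sum_distrib_left[symmetric]
      by (simp add: power2_eq_square[of \<eta>] mult_ac)
  qed
  \<comment> \<open>The shift that restores mass 1 after the increment.\<close>
  define t where "t = - ln S / \<eta>"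
  have exp_t: "exp (\<eta> * t) = 1 / S" using eta_pos S_pos by (simp add: t_def exp_minus inverse_eq_divide)
  define \<alpha> where "\<alpha> = vec (K + L) (\<lambda>m. a $ m + \<delta> m)"
  have d: "\<alpha> $ m - a $ m = \<delta> m" if "m < K + L" for m using that by (simp add: \<alpha>_def)
  have "(\<Sum>i<n. \<Sum>j<n. P ?z $$ (i, j) *
        (1 - exp (\<eta> * t) * exp (\<eta> * (\<Sum>m<K + L. (\<alpha> $ m - a $ m) * D m $$ (i, j)))))
      = (\<Sum>i<n. \<Sum>j<n. p (i, j) * (1 - exp (\<eta> * t) * exp (u (i, j))))"
    by (simp add: d u_def p_def)
  also have "\<dots> = (\<Sum>ij\<in>I. p ij) - exp (\<eta> * t) * S"
    unfolding double[of "\<lambda>ij. p ij * (1 - exp (\<eta> * t) * exp (u ij))"] S_def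
    by (simp add: right_diff_distrib sum_subtractf sum_distrib_left mult_ac)
  also have "\<dots> = 0" using S_pos by (simp add: p_sum exp_t)
  finally have "f (x + t \<cdot>\<^sub>v ones n, y, \<alpha>) - f ?z =
      t + 1 / \<eta> * (\<Sum>k<K. weight ?z k * (1 - exp (- \<eta> * (\<alpha> $ k - a $ k))))"
    unfolding f_increment_shift_a[OF x] by simp
  also have "1 / \<eta> * (\<Sum>k<K. weight ?z k * (1 - exp (- \<eta> * (\<alpha> $ k - a $ k))))
      = (\<Sum>k<K. weight ?z k * (1 - exp (- \<eta> * \<delta> k)) / \<eta>)"
    by (simp add: d sum_divide_distrib)
  finally have incr: "f (x + t \<cdot>\<^sub>v ones n, y, \<alpha>) - f ?z =
      t + (\<Sum>k<K. weight ?z k * (1 - exp (- \<eta> * \<delta> k)) / \<eta>)" .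
  have "ln S / \<eta> \<le> (\<eta> * (\<Sum>m<K + L. \<delta> m * mat_dot (P ?z) (D m))
      + 2 * (\<eta> * (\<Sum>m<K + L. \<eta> * real (K + L) * cd\<^sup>2 * (\<delta> m)\<^sup>2))) / \<eta>"
    using ln_S M2 eta_pos unfolding mean by (intro divide_right_mono) auto
  also have "\<dots> = (\<Sum>m<K + L. \<delta> m * mat_dot (P ?z) (D m))
      + (\<Sum>m<K + L. 2 * \<eta> * real (K + L) * cd\<^sup>2 * (\<delta> m)\<^sup>2)"
  proof -
    have "(\<Sum>m<K + L. 2 * \<eta> * real (K + L) * cd\<^sup>2 * (\<delta> m)\<^sup>2)
        = 2 * (\<Sum>m<K + L. \<eta> * real (K + L) * cd\<^sup>2 * (\<delta> m)\<^sup>2)"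
      by (simp add: sum_distrib_left mult.assoc)
    moreover have "(\<eta> * X + 2 * (\<eta> * Y)) / \<eta> = X + 2 * Y" for X Y
      using eta_pos by (simp add: add_divide_distrib)
    ultimately show ?thesis by simp
  qed
  finally have "- t \<le> (\<Sum>m<K + L. \<delta> m * mat_dot (P ?z) (D m))
      + (\<Sum>m<K + L. 2 * \<eta> * real (K + L) * cd\<^sup>2 * (\<delta> m)\<^sup>2)" by (simp add: t_def)
  with incr show ?thesis
    by (intro bexI[of _ \<alpha>] exI[of _ t]) (linarith, simp add: \<alpha>_def)
qed

text \<open>
  As the lower bound is separable, the coordinates of the increment can be chosen one at a time. If all constraint
  matrices vanish, then \<open>Q\<^sub>a = 0\<close> by the convention on division by zero, and the current point serves.
\<close>
lemma a_step_gain: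
  assumes x: "x \<in> carrier_vec n" and a: "a \<in> carrier_vec (K + L)" and mass: "mass (x, y, a) = 1"
  shows "\<exists>\<alpha>\<in>carrier_vec (K + L). \<exists>t. f (x, y, a) + Qa (x, y, a) / 4 \<le> f (x + t \<cdot>\<^sub>v ones n, y, \<alpha>)"
proof (cases "K + L = 0 \<or> cd = 0")
  case True
  then have "Qa (x, y, a) = 0" unfolding Qa_eq using eta_pos by auto
  moreover have "x + 0 \<cdot>\<^sub>v ones n = x" using x by (auto simp: ones_def)
  ultimately show ?thesis using a by (intro bexI[of _ a] exI[of _ 0]) auto
next
  case False
  then have N: "0 < real (K + L)" and cd: "0 < cd" using cd_nonneg by auto
  let ?z = "(x, y, a)"
  define p where "p m = mat_dot (P ?z) (D m)" for m
  define E where "E = 2 * \<eta> * real (K + L) * cd\<^sup>2"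
  define qi where "qi k = \<bar>slack ?z k\<bar> * min (1 / (8 * \<eta>))
        (\<bar>slack ?z k\<bar> / (8 * \<eta> * cd + 4 * \<eta> * real (K + L) * cd\<^sup>2))" for k
  define qe where "qe l = (slack ?z (K + l))\<^sup>2 / (2 * \<eta> * real (K + L) * cd\<^sup>2)" for l
  have "\<exists>\<delta>. 1 / 4 * qi k \<le> weight ?z k * (1 - exp (- \<eta> * \<delta>)) / \<eta> - \<delta> * p k - E * \<delta>\<^sup>2"
    if "k < K" for k
  proof -
    have "\<bar>p k\<bar> \<le> cd" using P_dot_D_le[of k ?z] that mass by (simp add: p_def)
    moreover have "0 < weight ?z k" by (simp add: weight_def)
    ultimately show ?thesis
      using inequality_coordinate_gain[OF eta_pos, of "weight ?z k" "p k" cd "real (K + L)"] cd that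
      by (simp add: qi_def slack_def E_def p_def del: of_nat_add)
  qed
  then obtain \<delta>i where \<delta>i: "\<And>k. k < K \<Longrightarrow>
      1 / 4 * qi k \<le> weight ?z k * (1 - exp (- \<eta> * \<delta>i k)) / \<eta> - \<delta>i k * p k - E * (\<delta>i k)\<^sup>2"
    by metis
  have "\<exists>\<delta>. 1 / 4 * qe l \<le> - \<delta> * p (K + l) - E * \<delta>\<^sup>2" for l
    using equality_coordinate_gain[OF eta_pos cd N, of "p (K + l)"]
    by (simp add: qe_def slack_def E_def p_def del: of_nat_add)
  then obtain \<delta>e where \<delta>e: "\<And>l. 1 / 4 * qe l \<le> - \<delta>e l * p (K + l) - E * (\<delta>e l)\<^sup>2"
    by metis
  define \<delta> where "\<delta> m = (if m < K then \<delta>i m else \<delta>e (m - K))" for m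
  have "Qa ?z / 4 = (\<Sum>k<K. 1 / 4 * qi k) + (\<Sum>l<L. 1 / 4 * qe l)"
    unfolding Qa_eq by (simp add: qi_def qe_def sum_divide_distrib add_divide_distrib)
  also have "\<dots> \<le> (\<Sum>k<K. weight ?z k * (1 - exp (- \<eta> * \<delta>i k)) / \<eta> - \<delta>i k * p k - E * (\<delta>i k)\<^sup>2)
      + (\<Sum>l<L. - \<delta>e l * p (K + l) - E * (\<delta>e l)\<^sup>2)"
    using \<delta>i \<delta>e by (intro add_mono sum_mono) auto
  also have "\<dots> = - (\<Sum>m<K + L. \<delta> m * p m) - (\<Sum>m<K + L. E * (\<delta> m)\<^sup>2)
      + (\<Sum>k<K. weight ?z k * (1 - exp (- \<eta> * \<delta> k)) / \<eta>)"
    unfolding sum_lessThan_add by (simp add: \<delta>_def sum_subtractf sum_negf)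
  finally have "Qa ?z / 4 \<le> - (\<Sum>m<K + L. \<delta> m * p m) - (\<Sum>m<K + L. E * (\<delta> m)\<^sup>2)
      + (\<Sum>k<K. weight ?z k * (1 - exp (- \<eta> * \<delta> k)) / \<eta>)" .
  moreover obtain \<alpha> t where "\<alpha> \<in> carrier_vec (K + L)" and "f ?z - (\<Sum>m<K + L. \<delta> m * p m)
      - (\<Sum>m<K + L. E * (\<delta> m)\<^sup>2) + (\<Sum>k<K. weight ?z k * (1 - exp (- \<eta> * \<delta> k)) / \<eta>)
      \<le> f (x + t \<cdot>\<^sub>v ones n, y, \<alpha>)"
    using a_step_lower_bound[OF x a mass, of \<delta>] unfolding p_def[symmetric] E_def[symmetric] by blast
  ultimately show ?thesis by (intro bexI[of _ \<alpha>] exI[of _ t]) linarith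
qed

end

section \<open>Large gradients have large scores\<close>

text \<open>
  The second factor is an upper bound for the 4 of the Pinsker inequality, for \<open>8\<eta>\<close> and for the two other denominators
  in \<open>Q\<^sub>a\<close>. The first one comes from splitting the gradient norm into \<open>N + 2\<close> parts, where \<open>N = K + L\<close>. The
  absolute value makes the constant positive for every \<open>d\<close>; without constraints, \<open>c\<^sub>d\<close> is an unspecified number.
\<close>
definition score_constant :: "real \<Rightarrow> real \<Rightarrow> real \<Rightarrow> real" where
  "score_constant \<eta> N d = (N + 2)\<^sup>2 * (4 + 8 * \<eta> + 8 * \<eta> * \<bar>d\<bar> + 4 * \<eta> * N * d\<^sup>2)"

text \<open>
  Iterations from points of mass 1 need only \<open>(4 + \<eta>) * score_constant \<eta> N d\<close>. The factor 4 and the second summand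
  cover the starting point (\<open>initial_gap\<close>), where half of \<open>\<epsilon>\<close> is granted to the wrong mass.
\<close>
definition progress_constant :: "real \<Rightarrow> real \<Rightarrow> real \<Rightarrow> real" where
  "progress_constant \<eta> N d = 4 * (4 + \<eta>) * score_constant \<eta> N d + 36 * \<eta> * (2 + N * \<bar>d\<bar>)\<^sup>2"

locale solvable_dual_problem = dual_problem +
  fixes opt :: dual
  assumes optimal: "is_arg_max (lyapunov \<eta> n K L C D r c) (\<lambda>w. w \<in> dual_space n K L) opt"
begin

lemma opt_in: "opt \<in> dual_space n K L" and f_le_opt: "w \<in> dual_space n K L \<Longrightarrow> f w \<le> f opt"
  using optimal by (cases w; auto simp: is_arg_max_def not_less)+

text \<open>
  If \<open>r\<^sub>i = 0\<close>, then lowering \<open>x\<^sub>i\<close> strictly increases \<open>f\<close>, which contradicts the existence of a maximiser. The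
  next two lemmas use the existence of a maximiser in the same way.
\<close>
lemma r_pos:
  assumes i: "i < n"
  shows "0 < r $ i"
proof (rule ccontr)
  assume "\<not> 0 < r $ i"
  then have r0: "r $ i = 0" using r_nonneg[OF i] by simp
  obtain x y a where opt: "opt = (x, y, a)" by (cases opt)
  have x: "x \<in> carrier_vec n" using opt_in by (simp add: opt dual_space_def)
  have "(x + (- 1) \<cdot>\<^sub>v unit_vec n i, y, a) \<in> dual_space n K L"
    using opt_in x by (simp add: opt dual_space_def)
  from f_le_opt[OF this] have "1 / \<eta> * (row_sum opt i * (1 - exp (- \<eta>))) \<le> 0"
    unfolding opt f_x_direction[OF x i] by (simp add: r0)
  moreover have "0 < 1 / \<eta> * (row_sum opt i * (1 - exp (- \<eta>)))"
    using eta_pos row_sum_pos[OF i] by (intro mult_pos_pos) auto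
  ultimately show False by simp
qed

lemma c_pos:
  assumes j: "j < n"
  shows "0 < c $ j"
proof (rule ccontr)
  assume "\<not> 0 < c $ j"
  then have c0: "c $ j = 0" using c_nonneg[OF j] by simp
  obtain x y a where opt: "opt = (x, y, a)" by (cases opt)
  have y: "y \<in> carrier_vec n" using opt_in by (simp add: opt dual_space_def)
  have "(x, y + (- 1) \<cdot>\<^sub>v unit_vec n j, a) \<in> dual_space n K L"
    using opt_in y by (simp add: opt dual_space_def)
  from f_le_opt[OF this] have "1 / \<eta> * (col_sum opt j * (1 - exp (- \<eta>))) \<le> 0"
    unfolding opt f_y_direction[OF y j] by (simp add: c0)
  moreover have "0 < 1 / \<eta> * (col_sum opt j * (1 - exp (- \<eta>)))"
    using eta_pos col_sum_pos[OF j] by (intro mult_pos_pos) auto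
  ultimately show False by simp
qed

lemma cd_pos:
  assumes "0 < K"
  shows "0 < cd"
proof (rule ccontr)
  assume "\<not> 0 < cd"
  then have cd0: "cd = 0" using cd_nonneg assms by simp
  obtain x y a where opt: "opt = (x, y, a)" by (cases opt)
  have a: "a \<in> carrier_vec (K + L)" using opt_in by (simp add: opt dual_space_def)
  have m: "0 < K + L" using assms by simp
  have "(x, y, a + 1 \<cdot>\<^sub>v unit_vec (K + L) 0) \<in> dual_space n K L"
    using opt_in a by (simp add: opt dual_space_def)
  moreover have "D 0 $$ (i, j) = 0" if "i < n" "j < n" for i j
    using D_entry_le[OF m that] cd0 by simp
  ultimately have "1 / \<eta> * (weight opt 0 * (1 - exp (- \<eta>))) \<le> 0"
    using f_le_opt[of "(x, y, a + 1 \<cdot>\<^sub>v unit_vec (K + L) 0)"] assms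
    unfolding opt f_a_direction[OF a m] by simp
  moreover have "0 < 1 / \<eta> * (weight opt 0 * (1 - exp (- \<eta>)))"
    using eta_pos by (intro mult_pos_pos) (auto simp: weight_def)
  ultimately show False by simp
qed

lemma Qa_inequality_term_le:
  assumes "k < K"
  shows "\<bar>slack z k\<bar> * min (1 / (8 * \<eta>))
      (\<bar>slack z k\<bar> / (8 * \<eta> * cd + 4 * \<eta> * real (K + L) * cd\<^sup>2)) \<le> Qa z"
  unfolding Qa_eq using assms eta_pos cd_pos
  by (intro add_increasing2 member_le_sum sum_nonneg divide_nonneg_nonneg mult_nonneg_nonneg add_nonneg_nonneg
      min.boundedI) auto

lemma Qa_equality_term_le:
  assumes "l < L"
  shows "(slack z (K + l))\<^sup>2 / (2 * \<eta> * real (K + L) * cd\<^sup>2) \<le> Qa z"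
  unfolding Qa_eq using assms eta_pos cd_nonneg
  by (intro add_increasing member_le_sum sum_nonneg divide_nonneg_nonneg mult_nonneg_nonneg add_nonneg_nonneg
      min.boundedI) auto

text \<open>
  One of the \<open>K + L + 2\<close> parts of the gradient norm exceeds the average \<open>\<epsilon> / (K + L + 2)\<close>, and the score that
  belongs to this part is large. An inequality multiplier enters \<open>Q\<^sub>a\<close> only linearly when \<open>\<bar>d\<^sub>k\<bar>\<close> is large; this is where
  \<open>\<epsilon> \<le> 1\<close> is needed.
\<close>
lemma largest_score_bound:
  assumes mass: "mass z = 1" and \<epsilon>: "0 < \<epsilon>" "\<epsilon> \<le> 1" and res: "\<epsilon> < residual z"
  shows "\<epsilon>\<^sup>2 / score_constant \<eta> (real (K + L)) cd \<le> max (Qx z) (max (Qy z) (Qa z))"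
proof -
  define N where "N = real (K + L)"
  define B where "B = 4 + 8 * \<eta> + 8 * \<eta> * \<bar>cd\<bar> + 4 * \<eta> * N * cd\<^sup>2"
  define e where "e = \<epsilon> / (N + 2)"
  have N0: "0 \<le> N" by (simp add: N_def)
  have e: "0 < e" "e \<le> 1" using \<epsilon> N0 by (auto simp: e_def)
  have parts: "0 \<le> 8 * \<eta>" "0 \<le> 8 * \<eta> * \<bar>cd\<bar>" "0 \<le> 4 * \<eta> * N * cd\<^sup>2" using eta_pos N0 by auto
  have B: "4 \<le> B" "8 * \<eta> \<le> B" "8 * \<eta> * \<bar>cd\<bar> + 4 * \<eta> * N * cd\<^sup>2 \<le> B" "2 * \<eta> * N * cd\<^sup>2 \<le> B"
    unfolding B_def using parts by simp_all
  have eq: "\<epsilon>\<^sup>2 / score_constant \<eta> (real (K + L)) cd = e\<^sup>2 / B"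
    by (simp add: e_def B_def N_def score_constant_def power_divide)
  have "e < (\<Sum>i<n. \<bar>r $ i - row_sum z i\<bar>) \<or> e < (\<Sum>j<n. \<bar>c $ j - col_sum z j\<bar>)
      \<or> (\<exists>m<K + L. e < \<bar>slack z m\<bar>)"
  proof (rule ccontr)
    assume "\<not> ?thesis"
    then have *: "(\<Sum>i<n. \<bar>r $ i - row_sum z i\<bar>) \<le> e" "(\<Sum>j<n. \<bar>c $ j - col_sum z j\<bar>) \<le> e"
      "\<And>m. m < K + L \<Longrightarrow> \<bar>slack z m\<bar> \<le> e" by (meson not_less)+
    have "(\<Sum>m<K + L. \<bar>slack z m\<bar>) \<le> N * e"
      using sum_bounded_above[of "{..<K + L}" "\<lambda>m. \<bar>slack z m\<bar>" e] *(3) by (simp add: N_def)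
    then have "residual z \<le> (N + 2) * e" using * by (simp add: residual_def distrib_right)
    also have "\<dots> = \<epsilon>" using N0 by (simp add: e_def)
    finally show False using res by simp
  qed
  then consider "e < (\<Sum>i<n. \<bar>r $ i - row_sum z i\<bar>)" | "e < (\<Sum>j<n. \<bar>c $ j - col_sum z j\<bar>)"
    | m where "m < K" "e < \<bar>slack z m\<bar>" | l where "l < L" "e < \<bar>slack z (K + l)\<bar>"
    by (metis add_less_cancel_left le_add_diff_inverse not_less)
  then have "e\<^sup>2 / B \<le> Qx z \<or> e\<^sup>2 / B \<le> Qy z \<or> e\<^sup>2 / B \<le> Qa z"
  proof cases
    case 1
    then have "e\<^sup>2 \<le> (\<Sum>i<n. \<bar>r $ i - row_sum z i\<bar>)\<^sup>2" using e by (intro power_mono) auto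
    also have "\<dots> \<le> 4 * Qx z"
      unfolding Qx_eq using mass r_pos row_sum_pos r_sum by (intro pinsker_quarter) (auto simp: mass_rows)
    finally have "e\<^sup>2 / 4 \<le> Qx z" by simp
    moreover have "e\<^sup>2 / B \<le> e\<^sup>2 / 4" using B by (intro divide_left_mono) auto
    ultimately show ?thesis by linarith
  next
    case 2
    then have "e\<^sup>2 \<le> (\<Sum>j<n. \<bar>c $ j - col_sum z j\<bar>)\<^sup>2" using e by (intro power_mono) auto
    also have "\<dots> \<le> 4 * Qy z"
      unfolding Qy_eq using mass c_pos col_sum_pos c_sum by (intro pinsker_quarter) (auto simp: mass_cols)
    finally have "e\<^sup>2 / 4 \<le> Qy z" by simp
    moreover have "e\<^sup>2 / B \<le> e\<^sup>2 / 4" using B by (intro divide_left_mono) auto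
    ultimately show ?thesis by linarith
  next
    case (3 m)
    have cd: "0 < cd" using cd_pos 3 by simp
    define \<beta> where "\<beta> = 8 * \<eta> * cd + 4 * \<eta> * real (K + L) * cd\<^sup>2"
    have \<beta>: "0 < \<beta>" "\<beta> \<le> B"
      using eta_pos cd B(3) by (auto simp: \<beta>_def N_def intro!: add_pos_nonneg)
    have "e / B \<le> min (1 / (8 * \<eta>)) (\<bar>slack z m\<bar> / \<beta>)"
    proof (rule min.boundedI)
      have "e / B \<le> 1 / B" using e B by (intro divide_right_mono) auto
      also have "\<dots> \<le> 1 / (8 * \<eta>)" using B eta_pos by (intro divide_left_mono) auto
      finally show "e / B \<le> 1 / (8 * \<eta>)" .
      show "e / B \<le> \<bar>slack z m\<bar> / \<beta>" using \<beta> e 3 by (intro frac_le) auto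
    qed
    then have "e * (e / B) \<le> \<bar>slack z m\<bar> * min (1 / (8 * \<eta>)) (\<bar>slack z m\<bar> / \<beta>)"
      using e 3 B by (intro mult_mono) auto
    also have "\<dots> \<le> Qa z" unfolding \<beta>_def by (rule Qa_inequality_term_le) fact
    finally show ?thesis by (simp add: power2_eq_square)
  next
    case (4 l)
    have m: "K + l < K + L" using 4 by simp
    have "cd \<noteq> 0"
      using P_dot_D_le[OF m, of z] mass 4 e by (auto simp: slack_def)
    then have pos: "0 < 2 * \<eta> * N * cd\<^sup>2" using eta_pos 4 by (auto simp: N_def)
    have "e\<^sup>2 \<le> (slack z (K + l))\<^sup>2" using 4 e power_mono[of e "\<bar>slack z (K + l)\<bar>" 2] by simp
    then have "e\<^sup>2 / B \<le> (slack z (K + l))\<^sup>2 / (2 * \<eta> * N * cd\<^sup>2)"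
      using pos B e by (intro frac_le) auto
    also have "\<dots> \<le> Qa z" unfolding N_def by (rule Qa_equality_term_le) fact
    finally show ?thesis by simp
  qed
  then show ?thesis unfolding eq by linarith
qed

section \<open>Progress of an iteration and distance to the maximum\<close>

text \<open>
  Brings the gains \<open>Q\<^sub>x/\<eta>\<close>, \<open>Q\<^sub>y/\<eta>\<close> and \<open>Q\<^sub>a/4\<close> of the three kinds of updates to a common scale.
\<close>
lemma scaled_gain:
  assumes "0 \<le> b" "b \<le> q" and "g + q / \<eta> \<le> h \<or> g + q / 4 \<le> h"
  shows "g + b / (4 + \<eta>) \<le> h"
proof -
  have "b / (4 + \<eta>) \<le> q / \<eta>" "b / (4 + \<eta>) \<le> q / 4"
    using assms(1,2) eta_pos by (intro frac_le; simp)+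
  then show ?thesis using assms by linarith
qed

lemma greedy_step_gain:
  assumes step: "greedy_step \<eta> n K L C D r c z z'" and z: "z \<in> dual_space n K L" and mass: "mass z = 1"
    and b: "0 \<le> b" "b \<le> max (Qx z) (max (Qy z) (Qa z))"
  shows "f z + b / (4 + \<eta>) \<le> f z'"
proof -
  obtain x y a where xya: "z = (x, y, a)" and x: "x \<in> carrier_vec n" and a: "a \<in> carrier_vec (K + L)"
    using z by (auto simp: dual_space_def)
  from step consider "Qy z \<le> Qx z" "Qa z \<le> Qx z" "x_update n f z z'"
    | "Qx z \<le> Qy z" "Qa z \<le> Qy z" "y_update n f z z'"
    | "Qx z \<le> Qa z" "Qy z \<le> Qa z" "a_update n K L f z z'"
    unfolding greedy_step_def Let_def by blast
  then show ?thesis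
  proof cases
    case 1
    then have "f z + Qx z / \<eta> \<le> f z'"
      using x_step_gain[OF mass[unfolded xya] r_pos] x_update_dest(3)[of x y a z'] z xya by fastforce
    then show ?thesis using scaled_gain[of b "Qx z"] b 1 by auto
  next
    case 2
    then have "f z + Qy z / \<eta> \<le> f z'"
      using y_step_gain[OF mass[unfolded xya] c_pos] y_update_dest(3)[of x y a z'] z xya by fastforce
    then show ?thesis using scaled_gain[of b "Qy z"] b 2 by auto
  next
    case 3
    obtain \<alpha> t where "\<alpha> \<in> carrier_vec (K + L)" "f z + Qa z / 4 \<le> f (x + t \<cdot>\<^sub>v ones n, y, \<alpha>)"
      using a_step_gain[OF x a mass[unfolded xya]] xya by auto
    then have "f z + Qa z / 4 \<le> f z'"
      using a_update_dest(3)[of x y a z' \<alpha> t] 3 z xya by simp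
    then show ?thesis using scaled_gain[of b "Qa z"] b 3 by auto
  qed
qed

lemma greedy_step_dest:
  assumes step: "greedy_step \<eta> n K L C D r c z z'" and z: "z \<in> dual_space n K L"
  shows "z' \<in> dual_space n K L" and "mass z' = 1" and "f z \<le> f z'"
proof -
  obtain x y a where xya: "z = (x, y, a)" and x: "x \<in> carrier_vec n" and y: "y \<in> carrier_vec n"
    and a: "a \<in> carrier_vec (K + L)"
    using z by (auto simp: dual_space_def)
  have zero: "x + 0 \<cdot>\<^sub>v ones n = x" using x by (auto simp: ones_def)
  from step have "x_update n f z z' \<or> y_update n f z z' \<or> a_update n K L f z z'"
    unfolding greedy_step_def Let_def by blast
  then have "z' \<in> dual_space n K L \<and> mass z' = 1 \<and> f z \<le> f z'"
    using x_update_dest(1,2)[of x y a z'] y_update_dest(1,2)[of x y a z'] a_update_dest(1,2)[of x y a z']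
      x_update_dest(3)[of x y a z' x] y_update_dest(3)[of x y a z' y] a_update_dest(3)[of x y a z' a 0] z x y a
    unfolding xya zero by blast
  then show "z' \<in> dual_space n K L" and "mass z' = 1" and "f z \<le> f z'" by auto
qed

text \<open>
  The points that witness the gains are competitors of the maximiser as well.
\<close>
lemma optimality_gap:
  assumes z: "z \<in> dual_space n K L" and mass: "mass z = 1"
    and b: "0 \<le> b" "b \<le> max (Qx z) (max (Qy z) (Qa z))"
  shows "f z + b / (4 + \<eta>) \<le> f opt"
proof -
  obtain x y a where xya: "z = (x, y, a)" and x: "x \<in> carrier_vec n" and y: "y \<in> carrier_vec n"
    and a: "a \<in> carrier_vec (K + L)"
    using z by (auto simp: dual_space_def)
  obtain \<xi> where \<xi>: "\<xi> \<in> carrier_vec n" "f z + Qx z / \<eta> \<le> f (\<xi>, y, a)"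
    using x_step_gain[OF mass[unfolded xya] r_pos] xya by auto
  obtain \<upsilon> where \<upsilon>: "\<upsilon> \<in> carrier_vec n" "f z + Qy z / \<eta> \<le> f (x, \<upsilon>, a)"
    using y_step_gain[OF mass[unfolded xya] c_pos] xya by auto
  obtain \<alpha> t where \<alpha>: "\<alpha> \<in> carrier_vec (K + L)" "f z + Qa z / 4 \<le> f (x + t \<cdot>\<^sub>v ones n, y, \<alpha>)"
    using a_step_gain[OF x a mass[unfolded xya]] xya by auto
  have "f z + Qx z / \<eta> \<le> f opt" "f z + Qy z / \<eta> \<le> f opt" "f z + Qa z / 4 \<le> f opt"
    using \<xi> \<upsilon> \<alpha> x y a f_le_opt[of "(\<xi>, y, a)"] f_le_opt[of "(x, \<upsilon>, a)"]
      f_le_opt[of "(x + t \<cdot>\<^sub>v ones n, y, \<alpha>)"] by (auto simp: dual_space_def)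
  then show ?thesis
    using scaled_gain[of b "Qx z"] scaled_gain[of b "Qy z"] scaled_gain[of b "Qa z"] b
    by (auto simp: le_max_iff_disj)
qed

section \<open>Starting points of arbitrary mass\<close>

lemma P_shift:
  assumes "x \<in> carrier_vec n" "i < n" "j < n"
  shows "P (x + t \<cdot>\<^sub>v ones n, y, a) $$ (i, j) = exp (\<eta> * t) * P (x, y, a) $$ (i, j)"
  using assms by (simp add: assoc_mat.simps ones_def algebra_simps flip: exp_add)

text \<open>
  Normalisation divides \<open>P\<close> by its mass and leaves the weights unchanged, so each part of the gradient moves by at most \<open>\<bar>s - 1\<bar>\<close>
  times a quantity of the normalised matrix: the mass 1 for the rows and for the columns, and at most
  \<open>c\<^sub>d\<close> for each multiplier.
\<close>
lemma residual_normalised: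
  fixes x y a :: "real vec"
  assumes x: "x \<in> carrier_vec n"
  defines "s \<equiv> mass (x, y, a)"
  defines "z' \<equiv> (x + (- ln s / \<eta>) \<cdot>\<^sub>v ones n, y, a)"
  shows "mass z' = 1" and "residual (x, y, a) \<le> residual z' + \<bar>s - 1\<bar> * (2 + real (K + L) * cd)"
proof -
  have s: "0 < s" unfolding s_def by (rule mass_pos)
  have P: "P (x, y, a) $$ (i, j) = s * P z' $$ (i, j)" if "i < n" "j < n" for i j
    unfolding z'_def P_shift[OF x that] using s eta_pos by (simp add: exp_minus)
  have row: "row_sum (x, y, a) i = s * row_sum z' i" if "i < n" for i
    using that by (simp add: row_sum_def P sum_distrib_left)
  have col: "col_sum (x, y, a) j = s * col_sum z' j" if "j < n" for j
    using that by (simp add: col_sum_def P sum_distrib_left)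
  have dot: "mat_dot (P (x, y, a)) (D m) = s * mat_dot (P z') (D m)" for m
    by (simp add: mat_dot_def P sum_distrib_left mult.assoc)
  have weight: "weight (x, y, a) m = weight z' m" for m by (simp add: weight_def z'_def)
  have "s = s * mass z'"
    using s_def by (simp add: mass_rows row sum_distrib_left)
  then show mass': "mass z' = 1" using s by simp
  have split: "\<bar>v - s * w\<bar> \<le> \<bar>v - w\<bar> + \<bar>s - 1\<bar> * \<bar>w\<bar>" for v w
  proof -
    have "v - s * w = (v - w) - (s - 1) * w" by (simp add: algebra_simps)
    then show ?thesis by (metis abs_mult abs_triangle_ineq4)
  qed
  have "(\<Sum>i<n. \<bar>r $ i - row_sum (x, y, a) i\<bar>) \<le> (\<Sum>i<n. \<bar>r $ i - row_sum z' i\<bar> + \<bar>s - 1\<bar> * row_sum z' i)"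
  proof (rule sum_mono)
    fix i assume "i \<in> {..<n}"
    then show "\<bar>r $ i - row_sum (x, y, a) i\<bar> \<le> \<bar>r $ i - row_sum z' i\<bar> + \<bar>s - 1\<bar> * row_sum z' i"
      using split[of "r $ i" "row_sum z' i"] row_sum_pos[of i z'] by (simp add: row)
  qed
  also have "\<dots> = (\<Sum>i<n. \<bar>r $ i - row_sum z' i\<bar>) + \<bar>s - 1\<bar>"
    using mass' by (simp add: sum.distrib mass_rows flip: sum_distrib_left)
  finally have 1: "(\<Sum>i<n. \<bar>r $ i - row_sum (x, y, a) i\<bar>) \<le> (\<Sum>i<n. \<bar>r $ i - row_sum z' i\<bar>) + \<bar>s - 1\<bar>" .
  have "(\<Sum>j<n. \<bar>c $ j - col_sum (x, y, a) j\<bar>) \<le> (\<Sum>j<n. \<bar>c $ j - col_sum z' j\<bar> + \<bar>s - 1\<bar> * col_sum z' j)"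
  proof (rule sum_mono)
    fix j assume "j \<in> {..<n}"
    then show "\<bar>c $ j - col_sum (x, y, a) j\<bar> \<le> \<bar>c $ j - col_sum z' j\<bar> + \<bar>s - 1\<bar> * col_sum z' j"
      using split[of "c $ j" "col_sum z' j"] col_sum_pos[of j z'] by (simp add: col)
  qed
  also have "\<dots> = (\<Sum>j<n. \<bar>c $ j - col_sum z' j\<bar>) + \<bar>s - 1\<bar>"
    using mass' by (simp add: sum.distrib mass_cols flip: sum_distrib_left)
  finally have 2: "(\<Sum>j<n. \<bar>c $ j - col_sum (x, y, a) j\<bar>) \<le> (\<Sum>j<n. \<bar>c $ j - col_sum z' j\<bar>) + \<bar>s - 1\<bar>" .
  have "(\<Sum>m<K + L. \<bar>slack (x, y, a) m\<bar>) \<le> (\<Sum>m<K + L. \<bar>slack z' m\<bar> + \<bar>s - 1\<bar> * cd)"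
  proof (rule sum_mono)
    fix m assume m: "m \<in> {..<K + L}"
    have "\<bar>s - 1\<bar> * \<bar>mat_dot (P z') (D m)\<bar> \<le> \<bar>s - 1\<bar> * cd"
      using P_dot_D_le[of m z'] m mass' by (intro mult_left_mono) auto
    then show "\<bar>slack (x, y, a) m\<bar> \<le> \<bar>slack z' m\<bar> + \<bar>s - 1\<bar> * cd"
      using split[of "if m < K then weight z' m else 0" "mat_dot (P z') (D m)"]
      unfolding slack_def dot weight by linarith
  qed
  also have "\<dots> = (\<Sum>m<K + L. \<bar>slack z' m\<bar>) + \<bar>s - 1\<bar> * (real (K + L) * cd)"
    by (simp add: sum.distrib)
  finally have 3: "(\<Sum>m<K + L. \<bar>slack (x, y, a) m\<bar>)
      \<le> (\<Sum>m<K + L. \<bar>slack z' m\<bar>) + \<bar>s - 1\<bar> * (real (K + L) * cd)" .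
  show "residual (x, y, a) \<le> residual z' + \<bar>s - 1\<bar> * (2 + real (K + L) * cd)"
  proof -
    have "\<bar>s - 1\<bar> * (2 + real (K + L) * cd) = \<bar>s - 1\<bar> + \<bar>s - 1\<bar> + \<bar>s - 1\<bar> * (real (K + L) * cd)"
      by (simp add: distrib_left)
    then show ?thesis using 1 2 3 unfolding residual_def by linarith
  qed
qed

abbreviation "\<kappa> \<equiv> progress_constant \<eta> (real (K + L)) cd"
abbreviation "\<sigma> \<equiv> score_constant \<eta> (real (K + L)) cd"

lemma \<sigma>_pos: "0 < \<sigma>"
  unfolding score_constant_def using eta_pos
  by (intro mult_pos_pos add_pos_nonneg add_nonneg_pos zero_less_power) auto

lemma \<kappa>_ge: "4 * (4 + \<eta>) * \<sigma> \<le> \<kappa>" "36 * \<eta> * (2 + real (K + L) * \<bar>cd\<bar>)\<^sup>2 \<le> \<kappa>"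
  unfolding progress_constant_def using eta_pos \<sigma>_pos by auto

lemma \<kappa>_pos: "0 < \<kappa>"
  using \<kappa>_ge(1) \<sigma>_pos eta_pos by (smt (verit) mult_pos_pos)

text \<open>
  Either the normalised point still has a gradient of norm more than \<open>\<epsilon>/2\<close>, or the mass differs from 1 by
  at least a multiple of \<open>\<epsilon>\<close> and normalising it gains enough.
\<close>
lemma initial_gap:
  assumes z: "z \<in> dual_space n K L" and \<epsilon>: "0 < \<epsilon>" "\<epsilon> \<le> 1" and res: "\<epsilon> < residual z"
  shows "f z + \<epsilon>\<^sup>2 / \<kappa> \<le> f opt"
proof -
  obtain x y a where xya: "z = (x, y, a)" and x: "x \<in> carrier_vec n" and y: "y \<in> carrier_vec n"
    and a: "a \<in> carrier_vec (K + L)"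
    using z by (auto simp: dual_space_def)
  define s where "s = mass z"
  have s: "0 < s" unfolding s_def by (rule mass_pos)
  define z' where "z' = (x + (- ln s / \<eta>) \<cdot>\<^sub>v ones n, y, a)"
  have z': "z' \<in> dual_space n K L" using x y a by (simp add: z'_def dual_space_def)
  have mass': "mass z' = 1" and res': "residual z \<le> residual z' + \<bar>s - 1\<bar> * (2 + real (K + L) * cd)"
    using residual_normalised[OF x, of y a] by (simp_all add: z'_def s_def xya)
  have fz': "f z' = f z + (s - 1 - ln s) / \<eta>"
    unfolding z'_def xya f_shift[OF x] using log_mass_shift[of z] by (simp add: s_def xya)
  have Ncd: "0 \<le> real (K + L) * cd" and Nabs: "real (K + L) * \<bar>cd\<bar> = real (K + L) * cd"
    using cd_nonneg by (cases "K + L = 0"; simp)+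
  show ?thesis
  proof (cases "\<epsilon> / 2 < residual z'")
    case True
    have "(\<epsilon> / 2)\<^sup>2 / \<sigma> \<le> max (Qx z') (max (Qy z') (Qa z'))"
      by (rule largest_score_bound[OF mass']) (use \<epsilon> True in auto)
    then have "f z' + (\<epsilon> / 2)\<^sup>2 / \<sigma> / (4 + \<eta>) \<le> f opt"
      using \<sigma>_pos by (intro optimality_gap[OF z' mass']) auto
    moreover have "\<epsilon>\<^sup>2 / \<kappa> \<le> \<epsilon>\<^sup>2 / (4 * (4 + \<eta>) * \<sigma>)"
      using \<kappa>_ge \<sigma>_pos eta_pos by (intro divide_left_mono mult_pos_pos \<kappa>_pos) auto
    moreover have "\<epsilon>\<^sup>2 / (4 * (4 + \<eta>) * \<sigma>) = (\<epsilon> / 2)\<^sup>2 / \<sigma> / (4 + \<eta>)"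
      by (simp add: power_divide mult_ac)
    moreover have "0 \<le> (s - 1 - ln s) / \<eta>"
      using s eta_pos ln_le_minus_one[OF s] by simp
    ultimately show ?thesis using fz' by linarith
  next
    case False
    define q where "q = 2 + real (K + L) * cd"
    have q: "2 \<le> q" using Ncd by (simp add: q_def)
    define \<delta> where "\<delta> = \<epsilon> / (2 * q)"
    have "\<epsilon> / 2 < \<bar>s - 1\<bar> * q" using False res res' by (simp add: q_def)
    then have "\<delta> \<le> \<bar>s - 1\<bar>" using q by (simp add: \<delta>_def field_simps)
    then have "\<delta>\<^sup>2 / 9 \<le> s - 1 - ln s"
      using s \<epsilon> q by (intro mass_defect_quadratic) (auto simp: \<delta>_def)
    then have "\<delta>\<^sup>2 / 9 / \<eta> \<le> (s - 1 - ln s) / \<eta>" using eta_pos by (intro divide_right_mono) auto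
    moreover have "\<delta>\<^sup>2 / 9 / \<eta> = \<epsilon>\<^sup>2 / (36 * \<eta> * q\<^sup>2)"
      by (simp add: \<delta>_def power_divide power_mult_distrib mult_ac)
    moreover have "\<epsilon>\<^sup>2 / \<kappa> \<le> \<epsilon>\<^sup>2 / (36 * \<eta> * q\<^sup>2)"
      using \<kappa>_ge(2) eta_pos q \<kappa>_pos unfolding Nabs q_def by (intro divide_left_mono mult_pos_pos) auto
    moreover have "f z' \<le> f opt" using f_le_opt z' by simp
    ultimately show ?thesis using fz' by linarith
  qed
qed

section \<open>Number of iterations\<close>

text \<open>
  If the gradient stays large up to time \<open>T\<close>, then \<open>c\<^sub>g\<close> is at least \<open>T \<epsilon>\<^sup>2 / \<kappa>\<close> from the iterations after the first,
  and at least \<open>\<epsilon>\<^sup>2 / \<kappa>\<close> from \<open>initial_gap\<close>. Together \<open>(T + 1) \<epsilon>\<^sup>2 / \<kappa> \<le> 2 c\<^sub>g\<close>; hence the factor 2 in the bound.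
\<close>
lemma greedy_run_reaches_small_residual:
  assumes run: "greedy_run \<eta> n K L C D r c init z" and \<epsilon>: "0 < \<epsilon>" "\<epsilon> \<le> 1"
  shows "\<exists>u. real u \<le> 2 * \<kappa> * (f opt - f init) / \<epsilon>\<^sup>2 \<and> z u \<in> dual_space n K L \<and> residual (z u) \<le> \<epsilon>"
proof (rule ccontr)
  assume contra: "\<not> ?thesis"
  have z0: "z 0 = init" and init: "init \<in> dual_space n K L"
    and step: "greedy_step \<eta> n K L C D r c (z u) (z (Suc u))" for u
    using run by (auto simp: greedy_run_def)
  have dual: "z u \<in> dual_space n K L" for u
    by (induction u) (use z0 init greedy_step_dest(1)[OF step] in auto)
  define g where "g = f opt - f init"
  \<comment> \<open>The last time that the claimed bound admits.\<close>
  define T where "T = nat \<lfloor>2 * \<kappa> * g / \<epsilon>\<^sup>2\<rfloor>"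
  have g0: "0 \<le> g" using f_le_opt[OF init] by (simp add: g_def)
  have bound0: "0 \<le> 2 * \<kappa> * g / \<epsilon>\<^sup>2" using g0 \<kappa>_pos by simp
  have large: "\<epsilon> < residual (z u)" if "u \<le> T" for u
  proof -
    have "real u \<le> real T" using that by simp
    also have "\<dots> \<le> 2 * \<kappa> * g / \<epsilon>\<^sup>2" unfolding T_def using bound0 by (rule of_nat_floor)
    finally show ?thesis unfolding g_def using contra dual by (meson not_le)
  qed
  have gain: "f (z (Suc u)) + \<epsilon>\<^sup>2 / \<kappa> \<le> f (z (Suc (Suc u)))" if "Suc u \<le> T" for u
  proof -
    have mass: "mass (z (Suc u)) = 1" using greedy_step_dest(2)[OF step dual] .
    have "\<epsilon>\<^sup>2 / \<kappa> \<le> \<epsilon>\<^sup>2 / ((4 + \<eta>) * \<sigma>)"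
    proof (rule divide_left_mono)
      have "0 \<le> (4 + \<eta>) * \<sigma>" using eta_pos \<sigma>_pos by simp
      then show "(4 + \<eta>) * \<sigma> \<le> \<kappa>" using \<kappa>_ge(1) unfolding mult.assoc by linarith
    qed (use eta_pos \<sigma>_pos \<kappa>_pos in auto)
    moreover have "f (z (Suc u)) + \<epsilon>\<^sup>2 / \<sigma> / (4 + \<eta>) \<le> f (z (Suc (Suc u)))"
      using largest_score_bound[OF mass \<epsilon> large[OF that]] \<sigma>_pos
      by (intro greedy_step_gain[OF step dual mass]) auto
    ultimately show ?thesis by (simp add: mult.commute)
  qed
  have climb: "f init + real u * (\<epsilon>\<^sup>2 / \<kappa>) \<le> f (z (Suc u))" if "u \<le> T" for u
    using that
  proof (induction u)
    case 0
    then show ?case using greedy_step_dest(3)[OF step dual, of 0] z0 by simp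
  next
    case (Suc u)
    then show ?case using gain[of u] by (simp add: distrib_right add_divide_distrib)
  qed
  have "real T * (\<epsilon>\<^sup>2 / \<kappa>) \<le> g"
    using climb[of T] f_le_opt[OF dual, of "Suc T"] by (simp add: g_def)
  moreover have "\<epsilon>\<^sup>2 / \<kappa> \<le> g"
    using initial_gap[OF init \<epsilon>] large[of 0] z0 by (simp add: g_def)
  ultimately have "(real T + 1) * (\<epsilon>\<^sup>2 / \<kappa>) \<le> 2 * g" by (simp add: distrib_right add_divide_distrib)
  then have "real T + 1 \<le> 2 * \<kappa> * g / \<epsilon>\<^sup>2"
    using \<kappa>_pos \<epsilon> by (simp add: field_simps)
  moreover have "2 * \<kappa> * g / \<epsilon>\<^sup>2 < real T + 1"
    unfolding T_def using bound0 by linarith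
  ultimately show False by simp
qed

text \<open>
  For an inequality constraint with \<open>P \<cdot> D\<^sub>k < 0\<close> the positive weight only enlarges \<open>d\<^sub>k\<close>.
\<close>
lemma constraint_violation_le_residual:
  "l1_norm (P z *\<^sub>v ones n - r) + l1_norm (transpose_mat (P z) *\<^sub>v ones n - c)
     + (\<Sum>k<K. \<bar>min (mat_dot (P z) (D k)) 0\<bar>) + (\<Sum>l<L. \<bar>mat_dot (P z) (D (K + l))\<bar>) \<le> residual z"
proof -
  have "l1_norm (P z *\<^sub>v ones n - r) = (\<Sum>i<n. \<bar>r $ i - row_sum z i\<bar>)"
    using r_carrier by (simp add: l1_norm_def P_mult_ones abs_minus_commute del: index_mult_mat_vec)
  moreover have "l1_norm (transpose_mat (P z) *\<^sub>v ones n - c) = (\<Sum>j<n. \<bar>c $ j - col_sum z j\<bar>)"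
    using c_carrier by (simp add: l1_norm_def P_transpose_mult_ones abs_minus_commute del: index_mult_mat_vec)
  moreover have "(\<Sum>k<K. \<bar>min (mat_dot (P z) (D k)) 0\<bar>) \<le> (\<Sum>k<K. \<bar>slack z k\<bar>)"
  proof (rule sum_mono)
    fix k assume "k \<in> {..<K}"
    moreover have "0 < weight z k" by (simp add: weight_def)
    ultimately show "\<bar>min (mat_dot (P z) (D k)) 0\<bar> \<le> \<bar>slack z k\<bar>"
      by (auto simp: slack_def min_def)
  qed
  moreover have "(\<Sum>l<L. \<bar>mat_dot (P z) (D (K + l))\<bar>) = (\<Sum>l<L. \<bar>slack z (K + l)\<bar>)"
    by (simp add: slack_def)
  ultimately show ?thesis by (simp add: residual_def sum_lessThan_add)
qed

end

theorem theorem3: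
  shows "\<exists>A :: real \<Rightarrow> nat \<Rightarrow> nat \<Rightarrow> real \<Rightarrow> real.
    \<forall>(\<eta> :: real) (n :: nat) (K :: nat) (L :: nat) (C :: real mat) (D :: nat \<Rightarrow> real mat)
      (r :: real vec) (c :: real vec) (init :: dual) (opt :: dual) (z :: nat \<Rightarrow> dual) (\<epsilon> :: real).
      0 < \<eta> \<longrightarrow>
      C \<in> carrier_mat n n \<longrightarrow>
      (\<forall>m<K + L. D m \<in> carrier_mat n n) \<longrightarrow>
      density n r \<longrightarrow>
      density n c \<longrightarrow>
      is_arg_max (lyapunov \<eta> n K L C D r c) (\<lambda>w. w \<in> dual_space n K L) opt \<longrightarrow>
      greedy_run \<eta> n K L C D r c init z \<longrightarrow>
      0 < \<epsilon> \<longrightarrow> \<epsilon> \<le> 1 \<longrightarrow>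
      (let f = lyapunov \<eta> n K L C D r c;
           c_g = f opt - f init
       in \<exists>u. real u \<le> A \<eta> K L (c_d K L D) * c_g / \<epsilon>\<^sup>2 \<and>
            l1_norm (gradient n K L f (z u)) \<le> \<epsilon> \<and>
            (let P = assoc_mat \<eta> n K L C D (z u)
             in l1_norm (P *\<^sub>v ones n - r) + l1_norm (transpose_mat P *\<^sub>v ones n - c)
                + (\<Sum>k<K. \<bar>min (mat_dot P (D k)) 0\<bar>)
                + (\<Sum>l<L. \<bar>mat_dot P (D (K + l))\<bar>) \<le> \<epsilon>))"
proof (intro exI[of _ "\<lambda>\<eta> K L d. 2 * progress_constant \<eta> (real (K + L)) d"] allI impI, goal_cases)
  case (1 \<eta> n K L C D r c init opt z \<epsilon>)
  interpret solvable_dual_problem \<eta> n K L C D r c opt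
    using 1 by unfold_locales auto
  obtain u where "real u \<le> 2 * \<kappa> * (f opt - f init) / \<epsilon>\<^sup>2" "z u \<in> dual_space n K L" "residual (z u) \<le> \<epsilon>"
    using greedy_run_reaches_small_residual 1 by blast
  then show ?case
    unfolding Let_def using l1_norm_gradient[of "z u"] constraint_violation_le_residual[of "z u"]
    by (intro exI[of _ u]) auto
qed

end
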